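(* Let $\mathcal{G} : \mathcal{P}_2(\mathbb{R}^d) \to (-\infty,+\infty]$ be proper, lower semicontinuous (with respect to $W_2$) and convex along generalized geodesics, with $\operatorname{arg\,min} \mathcal{G} \neq \emptyset$. Let $\{\epsilon_n\}_{n\ge 0}\subset \mathbb{R}_{\geq 0}$ with $\sum_{n=0}^{\infty} \epsilon_n < \infty$ and let $\{\tau_n\}_{n\ge 0} \subset \mathbb{R}_{> 0}$ with $\sum_{i=0}^{\infty}\tau_i= \infty$. Define $\sigma_n:= \sum_{i=0}^{n-1}\tau_i$ for $n\in\mathbb{N}$, and suppose $\sum_{n=1}^{\infty}\frac{\sigma_n}{\tau_n}\epsilon_{n-1}^2 < \infty$. Let $\{\mu_n\}_{n\ge 0}\subset \mathcal{P}_2(\mathbb{R}^d)$ satisfy $$W_2(\mu_{n+1}, J_{\tau_n}(\mu_n)) \leq \epsilon_n \quad \text{for all } n\in\mathbb{N}.$$ Then $$\mathcal{G}(J_{\tau_n}(\mu_n))-\inf \mathcal{G} = O\left(\frac{1}{\sigma_n}\right) \quad \text{as } n\to \infty,$$ and there exists $\mu^*\in \operatorname{arg\,min} \mathcal{G}$ such that $W_p(\mu_n,\mu^* )\to 0$ for all $p\in [1,2)$.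
   Context: $\mathbb{N}$ includes $0$. $\mathcal{P}_2(\mathbb{R}^d)$ is the set of Borel probability measures on $\mathbb{R}^d$ with finite second moment. For $p\in[1,2]$, $W_p$ is the $p$-Wasserstein distance for the Euclidean cost, $W_p^p(\mu,\nu)=\inf_{\gamma\in\Gamma(\mu,\nu)}\int\|x-y\|^p\,d\gamma$, with $\Gamma(\mu,\nu)$ the set of couplings; $\Gamma_{\rm opt}(\mu,\nu)$ is the set of optimal couplings for $p=2$. A generalized geodesic between $\mu_0,\mu_1\in\mathcal{P}_2(\mathbb{R}^d)$ with base $\nu\in\mathcal{P}_2(\mathbb{R}^d)$ is a curve $\mu_t=((1-t)\pi^2+t\pi^3)_{\#}\gamma$, $t\in[0,1]$, where $\gamma$ is a probability measure on $(\mathbb{R}^d)^3$ with marginals $\nu,\mu_0,\mu_1$ such that $\pi^{1,2}_{\#}\gamma\in\Gamma_{\rm opt}(\nu,\mu_0)$ and $\pi^{1,3}_{\#}\gamma\in\Gamma_{\rm opt}(\nu,\mu_1)$ ($\pi^i$, $\pi^{i,j}$ are the coordinate projections). A proper function $\mathcal{G}$ is convex along generalized geodesics if for every $\mu_0,\mu_1,\nu\in\mathcal{P}_2(\mathbb{R}^d)$ there is a generalized geodesic $(\mu_s)_{s\in[0,1]}$ between $\mu_0$ and $\mu_1$ with base $\nu$ such that $\mathcal{G}(\mu_s)\le(1-s)\mathcal{G}(\mu_0)+s\,\mathcal{G}(\mu_1)$ for all $s\in[0,1]$. For $\tau>0$, $J_\tau(\mu)$ is the minimizer of $\nu\mapsto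 \mathcal{G}(\nu)+\frac{1}{2\tau}W_2^2(\nu,\mu)$ over $\mathcal{P}_2(\mathbb{R}^d)$; under the assumptions above it exists and is unique for every $\mu\in\mathcal{P}_2(\mathbb{R}^d)$. *)

theory Defs
  imports "HOL-Probability.Probability" "HOL-Library.Landau_Symbols"
begin

definition P2 :: "'a::euclidean_space measure set" where
  "P2 = {\<mu>. prob_space \<mu> \<and> sets \<mu> = sets borel \<and> (\<integral>\<^sup>+ x. ennreal ((norm x)\<^sup>2) \<partial>\<mu>) < \<infinity>}"

definition couplings ::
    "'a::euclidean_space measure \<Rightarrow> 'a measure \<Rightarrow> ('a \<times> 'a) measure set" where
  "couplings \<mu> \<nu> = {\<gamma>. prob_space \<gamma> \<and> sets \<gamma> = sets borel \<and>
     distr \<gamma> borel fst = \<mu> \<and> distr \<gamma> borel snd = \<nu>}"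

definition transport_cost :: "real \<Rightarrow> ('a::euclidean_space \<times> 'a) measure \<Rightarrow> ennreal" where
  "transport_cost p \<gamma> = (\<integral>\<^sup>+ z. ennreal (norm (fst z - snd z) powr p) \<partial>\<gamma>)"

text \<open>Real-valued: for \<open>\<mu>, \<nu> \<in> P2\<close> and \<open>1 \<le> p \<le> 2\<close> the product coupling has finite cost, so
  \<^const>\<open>enn2real\<close> truncates nothing. The distance is only meant to be used in that range.\<close>

definition Wasserstein ::
    "real \<Rightarrow> 'a::euclidean_space measure \<Rightarrow> 'a measure \<Rightarrow> real" where
  "Wasserstein p \<mu> \<nu> = enn2real (INF \<gamma>\<in>couplings \<mu> \<nu>. transport_cost p \<gamma>) powr (1 / p)"

definition opt_couplings ::
    "'a::euclidean_space measure \<Rightarrow> 'a measure \<Rightarrow> ('a \<times> 'a) measure set" where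
  "opt_couplings \<mu> \<nu> = {\<gamma>. is_arg_min (transport_cost 2) (\<lambda>\<gamma>. \<gamma> \<in> couplings \<mu> \<nu>) \<gamma>}"

text \<open>The base measure \<open>\<nu>\<close> comes first. Values of the curve outside \<open>[0,1]\<close> are unconstrained.\<close>

definition generalized_geodesic ::
    "'a::euclidean_space measure \<Rightarrow> 'a measure \<Rightarrow> 'a measure \<Rightarrow> (real \<Rightarrow> 'a measure) \<Rightarrow> bool" where
  "generalized_geodesic \<nu> \<mu>\<^sub>0 \<mu>\<^sub>1 \<mu> \<longleftrightarrow>
     (\<exists>\<gamma> :: ('a \<times> 'a \<times> 'a) measure.
        prob_space \<gamma> \<and> sets \<gamma> = sets borel \<and>
        distr \<gamma> borel (\<lambda>(x, y, z). x) = \<nu> \<and>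
        distr \<gamma> borel (\<lambda>(x, y, z). y) = \<mu>\<^sub>0 \<and>
        distr \<gamma> borel (\<lambda>(x, y, z). z) = \<mu>\<^sub>1 \<and>
        distr \<gamma> borel (\<lambda>(x, y, z). (x, y)) \<in> opt_couplings \<nu> \<mu>\<^sub>0 \<and>
        distr \<gamma> borel (\<lambda>(x, y, z). (x, z)) \<in> opt_couplings \<nu> \<mu>\<^sub>1 \<and>
        (\<forall>t\<in>{0..1}. \<mu> t = distr \<gamma> borel (\<lambda>(x, y, z). (1 - t) *\<^sub>R y + t *\<^sub>R z)))"

text \<open>A functional \<open>P2 \<rightarrow> (-\<infinity>, +\<infinity>]\<close> is encoded as a total function into \<^typ>\<open>ereal\<close>; its values
  outside \<^const>\<open>P2\<close> play no role.\<close>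

definition proper_on_P2 :: "('a::euclidean_space measure \<Rightarrow> ereal) \<Rightarrow> bool" where
  "proper_on_P2 G \<longleftrightarrow> (\<forall>\<mu>\<in>P2. G \<mu> \<noteq> -\<infinity>) \<and> (\<exists>\<mu>\<in>P2. G \<mu> \<noteq> \<infinity>)"

definition lsc_W2 :: "('a::euclidean_space measure \<Rightarrow> ereal) \<Rightarrow> bool" where
  "lsc_W2 G \<longleftrightarrow>
     (\<forall>\<mu>\<in>P2. \<forall>\<nu>. (\<forall>n::nat. \<nu> n \<in> P2) \<longrightarrow> (\<lambda>n. Wasserstein 2 (\<nu> n) \<mu>) \<longlonglongrightarrow> 0 \<longrightarrow>
        G \<mu> \<le> liminf (\<lambda>n. G (\<nu> n)))"

text \<open>In \<^typ>\<open>ereal\<close> we have \<open>0 * \<infinity> = 0\<close>; this only matters at \<open>s = 0\<close> and \<open>s = 1\<close>, where the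
  inequality is trivial because the curve starts at \<open>\<mu>\<^sub>0\<close> and ends at \<open>\<mu>\<^sub>1\<close>.\<close>

definition convex_along_gen_geodesics :: "('a::euclidean_space measure \<Rightarrow> ereal) \<Rightarrow> bool" where
  "convex_along_gen_geodesics G \<longleftrightarrow>
     (\<forall>\<mu>\<^sub>0\<in>P2. \<forall>\<mu>\<^sub>1\<in>P2. \<forall>\<nu>\<in>P2. \<exists>\<mu>. generalized_geodesic \<nu> \<mu>\<^sub>0 \<mu>\<^sub>1 \<mu> \<and>
        (\<forall>s\<in>{0..1}. G (\<mu> s) \<le> ereal (1 - s) * G \<mu>\<^sub>0 + ereal s * G \<mu>\<^sub>1))"

definition argmin_P2 :: "('a::euclidean_space measure \<Rightarrow> ereal) \<Rightarrow> 'a measure set" where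
  "argmin_P2 G = {\<mu>. is_arg_min G (\<lambda>\<mu>. \<mu> \<in> P2) \<mu>}"

text \<open>For \<open>\<tau> > 0\<close>, \<open>\<mu> \<in> P2\<close> and \<open>G\<close> proper, lower semicontinuous and convex along generalized
  geodesics, the minimizer exists and is unique; the description is junk otherwise.\<close>

definition JKO :: "('a::euclidean_space measure \<Rightarrow> ereal) \<Rightarrow> real \<Rightarrow> 'a measure \<Rightarrow> 'a measure" where
  "JKO G \<tau> \<mu> =
     (THE \<rho>. \<rho> \<in> argmin_P2 (\<lambda>\<nu>. G \<nu> + ereal (1 / (2 * \<tau>) * (Wasserstein 2 \<nu> \<mu>)\<^sup>2)))"

end

theory Submission imports Defs begin

text \<open>Write \<open>\<rho>\<^sub>n\<close> for the proximal point of \<open>\<mu>\<^sub>n\<close>. Convexity along generalized geodesics with base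
  \<open>\<mu>\<^sub>n\<close> yields the evolution variational inequality
  \<open>W(\<rho>\<^sub>n,\<nu>)\<^sup>2 \<le> W(\<mu>\<^sub>n,\<nu>)\<^sup>2 - 2 \<tau>\<^sub>n (G(\<rho>\<^sub>n) - G(\<nu>)) - W(\<mu>\<^sub>n,\<rho>\<^sub>n)\<^sup>2\<close>. Testing it with a minimizer makes \<open>\<mu>\<^sub>n\<close>
  quasi-Fejer monotone and \<open>\<tau>\<^sub>n (G(\<rho>\<^sub>n) - inf G)\<close> summable; testing it with the previous proximal point
  makes \<open>G(\<rho>\<^sub>n)\<close> almost decreasing, and the two facts together give the rate.

  For the convergence, sequences with bounded second moments have subsequences that are laws of
  almost surely convergent random variables, and an Opial inequality
  \<open>W(\<mu>\<^sub>n,\<nu>)\<^sup>2 \<ge> W(\<mu>\<^sub>n,\<rho>)\<^sup>2 + W(\<rho>,\<nu>)\<^sup>2 - o(1)\<close> holds for weak limits \<open>\<rho>\<close>. It gives completeness of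
  \<open>W\<^sub>2\<close> (hence existence of proximal points), uniqueness of the weak cluster point and, with the
  variational inequality at \<open>\<rho>\<close>, its minimality.\<close>

section \<open>Schoenberg's space-filling curve\<close>

text \<open>The obstacle is a gap between two topologies: \<open>G\<close> is lower semicontinuous
  for \<open>Wasserstein 2\<close>, but bounded second moments give compactness only for weak
  convergence, under which part of the second moment may be lost. Minimality of a weak limit is
  therefore not a direct consequence of lower semicontinuity; it comes from the proximal point of
  that limit, whose variational inequality cancels against the Opial inequality. The same loss
  explains the range p < 2: bounded second moments make the p-th powers uniformly integrable below
  exponent 2. The weights in the summability assumption come from summation by parts: the values at
  the proximal points grow by at most \<open>(\<epsilon> n)\<^sup>2 / (2 * \<tau> (Suc n))\<close>
  per step, and multiplying by the elapsed time \<open>\<sigma> (Suc n)\<close> has to leave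
  something summable. Almost surely convergent random variables stand in for the narrow topology, so
  that passages to the limit become applications of Fatou's lemma or dominated convergence.\<close>

definition schoenberg_wave :: "real \<Rightarrow> real" where
  "schoenberg_wave x = max 0 (min 1 (1 / 2 - cos (pi * x)))"

lemma schoenberg_wave_bounds: "0 \<le> schoenberg_wave x" "schoenberg_wave x \<le> 1"
  by (auto simp: schoenberg_wave_def)

lemma continuous_on_schoenberg_wave: "continuous_on S schoenberg_wave"
  unfolding schoenberg_wave_def by (intro continuous_intros)

text \<open>Clipping \<open>1 / 2 - cos (pi * x)\<close> to [0,1] gives a continuous wave of period
  2 that is 0 on [0,1/3] and 1 on [2/3,1]. It thus reads the first ternary digit
  \<open>2 * b\<close> behind the point: the period removes the even integer part, and
  \<open>u\<close> holds all later digits.\<close>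

lemma schoenberg_wave_digit:
  fixes N :: int and b :: nat and u :: real
  assumes "b \<in> {0, 1}" "0 \<le> u" "u \<le> 1 / 3"
  shows "schoenberg_wave (2 * N + 2 * b / 3 + u) = b"
proof -
  have "pi * (2 * N + 2 * b / 3 + u) = (2 * b / 3 + u) * pi + 2 * pi * of_int N"
    by (simp add: algebra_simps)
  then have c: "cos (pi * (2 * N + 2 * b / 3 + u)) = cos ((2 * b / 3 + u) * pi)"
    by (simp only: cos_add cos_int_2pin sin_int_2pin mult_1_right mult_zero_right diff_zero)
  show ?thesis
  proof (cases "b = 0")
    case True
    have "cos (pi / 3) \<le> cos (u * pi)"
      using assms pi_gt_zero by (intro cos_monotone_0_pi_le) (auto simp: field_simps)
    then show ?thesis using True c by (simp add: schoenberg_wave_def cos_60)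
  next
    case False
    then have b: "b = 1" using assms by auto
    have "cos ((2 / 3 + u) * pi) \<le> cos (2 * pi / 3)"
      using assms pi_gt_zero by (intro cos_monotone_0_pi_le) (auto simp: field_simps)
    also have "cos (2 * pi / 3) = - 1 / 2"
      by (simp add: cos_120)
    finally show ?thesis using b c by (simp add: schoenberg_wave_def)
  qed
qed

text \<open>The digits are the increments \<open>F (Suc k) - 2 * F k\<close> of the dyadic floors,
  so the series telescopes to partial sums \<open>F n / 2 ^ n\<close>, which lie within
  \<open>1 / 2 ^ n\<close> below \<open>y\<close>. The bound \<open>y < 1\<close> makes the constant
  term \<open>F 0\<close> vanish.\<close>

lemma binary_expansion:
  fixes y :: real
  assumes "0 \<le> y" "y < 1"
  shows "\<exists>a :: nat \<Rightarrow> nat. (\<forall>k. a k \<in> {0, 1}) \<and> (\<lambda>k. (1 / 2) ^ Suc k * real (a k)) sums y"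
proof -
  define F where "F k = \<lfloor>2 ^ k * y\<rfloor>" for k :: nat
  define a where "a k = nat (F (Suc k) - 2 * F k)" for k
  have F: "2 * F k \<le> F (Suc k) \<and> F (Suc k) \<le> 2 * F k + 1" for k
  proof -
    have "F (Suc k) = \<lfloor>2 * (2 ^ k * y)\<rfloor>" by (simp add: F_def mult.assoc)
    then show ?thesis unfolding F_def by linarith
  qed
  have "a k \<in> {0, 1}" for k using F[of k] by (auto simp: a_def)
  have "(1 / 2) ^ Suc k * real (a k) = F (Suc k) / 2 ^ Suc k - F k / 2 ^ k" for k
    using F[of k] by (simp add: a_def field_simps)
  moreover have "(\<lambda>k. of_int (F (Suc k)) / 2 ^ Suc k - of_int (F k) / 2 ^ k) sums (y - of_int (F 0) / 2 ^ 0)"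
  proof (rule telescope_sums)
    have lim: "(\<lambda>k. y - (1 / 2) ^ k) \<longlonglongrightarrow> y - 0"
      by (intro tendsto_intros LIMSEQ_power_zero) auto
    show "(\<lambda>k. of_int (F k) / 2 ^ k) \<longlonglongrightarrow> y"
    proof (rule tendsto_sandwich[OF _ _ lim[simplified] tendsto_const])
      show "\<forall>\<^sub>F k in sequentially. y - (1 / 2) ^ k \<le> of_int (F k) / 2 ^ k"
      proof (intro always_eventually allI)
        fix k
        have "2 ^ k * y \<le> of_int (F k) + 1" unfolding F_def by linarith
        then show "y - (1 / 2) ^ k \<le> of_int (F k) / 2 ^ k"
          using divide_right_mono[of "2 ^ k * y - 1" "of_int (F k)" "2 ^ k"]
          by (simp add: power_one_over diff_divide_distrib)
      qed
      show "\<forall>\<^sub>F k in sequentially. of_int (F k) / 2 ^ k \<le> y"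
      proof (intro always_eventually allI)
        fix k
        have "of_int (F k) \<le> 2 ^ k * y" unfolding F_def by linarith
        then show "of_int (F k) / 2 ^ k \<le> y" by (simp add: field_simps)
      qed
    qed
  qed
  moreover have "F 0 = 0" using assms by (simp add: F_def) linarith
  ultimately have "(\<lambda>k. (1 / 2) ^ Suc k * real (a k)) sums y"
    by (simp only:) simp
  with \<open>\<And>k. a k \<in> {0, 1}\<close> show ?thesis by blast
qed

text \<open>The coordinates of Schoenberg's curve: the digits of the base-3 expansion of \<open>t\<close> (all equal
  to 0 or 2 in the relevant case) at the positions congruent to \<open>i\<close> modulo \<open>d\<close> become
  the binary digits of the \<open>i\<close>-th coordinate.\<close>

definition schoenberg_coord :: "nat \<Rightarrow> nat \<Rightarrow> real \<Rightarrow> real" where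
  "schoenberg_coord d i t = (\<Sum>k. (1 / 2) ^ Suc k * schoenberg_wave (3 ^ (d * k + i) * t))"

lemma continuous_on_schoenberg_coord: "continuous_on S (schoenberg_coord d i)"
proof -
  let ?f = "\<lambda>k t. (1 / 2 :: real) ^ Suc k * schoenberg_wave (3 ^ (d * k + i) * t)"
  have sm: "summable (\<lambda>k. (1 / 2 :: real) ^ Suc k)"
    using summable_Suc_iff[of "\<lambda>k. (1 / 2 :: real) ^ k"] by (simp add: summable_geometric)
  have "uniform_limit S (\<lambda>n t. \<Sum>k<n. ?f k t) (\<lambda>t. \<Sum>k. ?f k t) sequentially"
  proof (rule Weierstrass_m_test[OF _ sm])
    show "norm (?f k t) \<le> (1 / 2) ^ Suc k" for k t
      using schoenberg_wave_bounds[of "3 ^ (d * k + i) * t"]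
      by (simp add: abs_mult mult_left_le del: power_Suc)
  qed
  moreover have "continuous_on S (\<lambda>t. \<Sum>k<n. ?f k t)" for n
    by (intro continuous_intros continuous_on_compose2[OF continuous_on_schoenberg_wave[of UNIV]]) auto
  ultimately show ?thesis
    unfolding schoenberg_coord_def
    by (intro uniform_limit_theorem[where F = sequentially]) auto
qed

text \<open>Multiplication by \<open>3 ^ m\<close> moves the first m digits in front of the point.
  As every digit is 0 or 2, they form an even integer, which the period 2 of the wave removes; the
  digits behind position m contribute \<open>?u / 3\<close> with \<open>?u\<close> in [0,1].\<close>

lemma schoenberg_wave_ternary:
  fixes c :: "nat \<Rightarrow> nat"
  assumes c: "\<And>j. c j \<in> {0, 1}"
  defines "t \<equiv> (\<Sum>j. 2 * real (c j) / 3 ^ Suc j)"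
  shows "t \<in> {0..1}" "schoenberg_wave (3 ^ m * t) = c m"
proof -
  have c': "0 \<le> real (c j)" "real (c j) \<le> 1" for j using c[of j] by auto
  have geo: "(\<lambda>j. 2 / 3 ^ Suc j :: real) sums 1"
    using sums_mult[OF geometric_sums[of "1 / 3 :: real"], of "2 / 3"] by (simp add: field_simps)
  have le: "2 * real (c j) / 3 ^ Suc j \<le> 2 / 3 ^ Suc j" for j
    using c'(2)[of j] by (intro divide_right_mono) auto
  have smd: "summable (\<lambda>j. 2 * real (c (j + n)) / 3 ^ Suc j)" for n
  proof (rule summable_comparison_test[OF _ sums_summable[OF geo]], intro exI allI impI)
    show "norm (2 * real (c (j + n)) / 3 ^ Suc j) \<le> 2 / 3 ^ Suc j" for j
      using c'(2)[of "j + n"] by (simp add: divide_right_mono)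
  qed
  have tail: "0 \<le> (\<Sum>j. 2 * real (c (j + n)) / 3 ^ Suc j)" "(\<Sum>j. 2 * real (c (j + n)) / 3 ^ Suc j) \<le> 1" for n
  proof -
    show "0 \<le> (\<Sum>j. 2 * real (c (j + n)) / 3 ^ Suc j)"
      by (intro suminf_nonneg smd) auto
    have "(\<Sum>j. 2 * real (c (j + n)) / 3 ^ Suc j) \<le> (\<Sum>j. 2 / 3 ^ Suc j)"
      using c' by (intro suminf_le smd sums_summable[OF geo] divide_right_mono) auto
    then show "(\<Sum>j. 2 * real (c (j + n)) / 3 ^ Suc j) \<le> 1" using sums_unique[OF geo] by simp
  qed
  show "t \<in> {0..1}" using tail[of 0] by (simp add: t_def)
  let ?u = "\<Sum>j. 2 * real (c (j + Suc m)) / 3 ^ Suc j"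
  have sm0: "summable (\<lambda>j. 2 * real (c j) / 3 ^ Suc j)" using smd[of 0] by simp
  have "t = (\<Sum>j. 2 * real (c (j + Suc m)) / 3 ^ Suc (j + Suc m)) + (\<Sum>j<Suc m. 2 * real (c j) / 3 ^ Suc j)"
    unfolding t_def by (rule suminf_split_initial_segment[OF sm0])
  also have "(\<Sum>j. 2 * real (c (j + Suc m)) / 3 ^ Suc (j + Suc m)) = ?u / 3 ^ Suc m"
    by (subst suminf_divide[OF smd, symmetric]) (simp add: power_add field_simps)
  finally have t: "3 ^ m * t = 3 ^ m * (\<Sum>j<m. 2 * real (c j) / 3 ^ Suc j) + 2 * real (c m) / 3 + ?u / 3"
    by (simp add: field_simps)
  have "3 ^ m * (\<Sum>j<m. 2 * real (c j) / 3 ^ Suc j) = (\<Sum>j<m. 2 * real (c j) * 3 ^ (m - Suc j))"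
    by (simp add: sum_distrib_left, intro sum.cong refl) (simp add: power_diff field_simps)
  also have "\<dots> = 2 * of_int (\<Sum>j<m. int (c j) * 3 ^ (m - Suc j))"
    by (simp add: sum_distrib_left mult.assoc)
  finally have N: "3 ^ m * t = 2 * of_int (\<Sum>j<m. int (c j) * 3 ^ (m - Suc j)) + 2 * real (c m) / 3 + ?u / 3"
    using t by simp
  show "schoenberg_wave (3 ^ m * t) = c m"
    unfolding N using schoenberg_wave_digit[OF c[of m], of "?u / 3" "\<Sum>j<m. int (c j) * 3 ^ (m - Suc j)"]
      tail[of "Suc m"] by (simp del: of_int_sum power_Suc add_Suc_right)
qed

lemma schoenberg_coord_surj:
  assumes "\<And>i. i < d \<Longrightarrow> 0 \<le> y i \<and> y i < 1"
  shows "\<exists>t\<in>{0..1}. \<forall>i<d. schoenberg_coord d i t = y i"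
proof -
  have "\<forall>i. \<exists>a :: nat \<Rightarrow> nat. i < d \<longrightarrow> (\<forall>k. a k \<in> {0, 1}) \<and> (\<lambda>k. (1 / 2) ^ Suc k * real (a k)) sums y i"
  proof
    fix i
    show "\<exists>a :: nat \<Rightarrow> nat. i < d \<longrightarrow> (\<forall>k. a k \<in> {0, 1}) \<and> (\<lambda>k. (1 / 2) ^ Suc k * real (a k)) sums y i"
      using binary_expansion[of "y i"] assms[of i] by (cases "i < d") (simp_all del: power_Suc)
  qed
  from choice[OF this]
  obtain a :: "nat \<Rightarrow> nat \<Rightarrow> nat" where
    "\<forall>i. i < d \<longrightarrow> (\<forall>k. a i k \<in> {0, 1}) \<and> (\<lambda>k. (1 / 2) ^ Suc k * real (a i k)) sums y i"
    by (elim exE)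
  then have a: "\<And>i k. i < d \<Longrightarrow> a i k \<in> {0, 1}" "\<And>i. i < d \<Longrightarrow> (\<lambda>k. (1 / 2) ^ Suc k * real (a i k)) sums y i"
    by blast+
  \<comment> \<open>Interleaving of d binary expansions: position \<open>d * k + i\<close> carries
    digit k of coordinate i. The branch for \<open>d = 0\<close> only keeps all digits in
    {0,1}.\<close>
  define c where "c j = (if d = 0 then 0 else a (j mod d) (j div d))" for j
  have c: "c j \<in> {0, 1}" for j using a(1)[of "j mod d" "j div d"] by (auto simp: c_def)
  show ?thesis
  proof (intro bexI[OF _ schoenberg_wave_ternary(1)[OF c]] allI impI)
    fix i assume i: "i < d"
    have "c (d * k + i) = a i k" for k using i by (simp add: c_def)
    then show "schoenberg_coord d i (\<Sum>j. 2 * real (c j) / 3 ^ Suc j) = y i"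
      unfolding schoenberg_coord_def schoenberg_wave_ternary(2)[OF c]
      using sums_unique[OF a(2)[OF i]] by simp
  qed
qed

lemma space_filling_curve:
  obtains h :: "real \<Rightarrow> 'a::euclidean_space" where "continuous_on UNIV h" "ball 0 1 \<subseteq> h ` {0..1}"
proof -
  obtain e where e: "bij_betw e {..<DIM('a)} (Basis :: 'a set)"
    using ex_bij_betw_nat_finite[OF finite_Basis] by (auto simp: lessThan_atLeast0)
  \<comment> \<open>The Schoenberg coordinates reach all of [0,1)^d; the affine rescaling moves this
    to [-1,1)^d, which contains the open unit ball.\<close>
  define h :: "real \<Rightarrow> 'a" where "h t = (\<Sum>i<DIM('a). (2 * schoenberg_coord DIM('a) i t - 1) *\<^sub>R e i)" for t
  show ?thesis
  proof
    show "continuous_on UNIV h"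
      unfolding h_def by (intro continuous_intros continuous_on_schoenberg_coord)
    show "ball 0 1 \<subseteq> h ` {0..1}"
    proof
      fix x :: 'a assume x: "x \<in> ball 0 1"
      have "0 \<le> (x \<bullet> e i + 1) / 2 \<and> (x \<bullet> e i + 1) / 2 < 1" if "i < DIM('a)" for i
      proof -
        have "e i \<in> Basis" using e that by (auto simp: bij_betw_def)
        then have "\<bar>x \<bullet> e i\<bar> < 1" using Basis_le_norm[of "e i" x] x by auto
        then show ?thesis by auto
      qed
      then obtain t where t: "t \<in> {0..1}" "\<forall>i<DIM('a). schoenberg_coord DIM('a) i t = (x \<bullet> e i + 1) / 2"
        using schoenberg_coord_surj[of "DIM('a)" "\<lambda>i. (x \<bullet> e i + 1) / 2"] by auto
      have "h t = (\<Sum>i<DIM('a). (x \<bullet> e i) *\<^sub>R e i)"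
        unfolding h_def by (intro sum.cong refl) (simp add: t(2) add_divide_distrib)
      also have "\<dots> = (\<Sum>b\<in>Basis. (x \<bullet> b) *\<^sub>R b)" by (rule sum.reindex_bij_betw[OF e])
      finally show "x \<in> h ` {0..1}" using t(1) by (auto simp: euclidean_representation)
    qed
  qed
qed

lemma Borel_section_compact:
  fixes h :: "real \<Rightarrow> 'b::t2_space" and \<phi> :: "'a::topological_space \<Rightarrow> 'b"
  assumes h: "continuous_on UNIV h" and \<phi>: "continuous_on UNIV \<phi>" "range \<phi> \<subseteq> h ` {0..1}"
  obtains s where "s \<in> borel_measurable borel" "\<And>x. s x \<in> {0..1}" "\<And>x. h (s x) = \<phi> x"
proof -
  define S where "S x = {0..1} \<inter> h -` {\<phi> x}" for x
  have cl: "closed (S x)" for x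
    unfolding S_def by (intro closed_Int closed_vimage) (auto intro: h)
  have ne: "S x \<noteq> {}" for x
  proof -
    have "\<phi> x \<in> h ` {0..1}" using \<phi>(2) by blast
    then show ?thesis by (auto simp: S_def)
  qed
  have bb: "bdd_below (S x)" for x by (auto simp: S_def intro!: bdd_belowI[of _ 0])
  have Inf_in: "Inf (S x) \<in> S x" for x using closed_contains_Inf[OF ne bb cl] .
  have le_iff: "{x. Inf (S x) \<le> a} = \<phi> -` (h ` ({0..1} \<inter> {..a}))" for a
  proof (intro set_eqI iffI)
    fix x assume "x \<in> {x. Inf (S x) \<le> a}"
    then show "x \<in> \<phi> -` (h ` ({0..1} \<inter> {..a}))"
      using Inf_in[of x] by (auto simp: S_def intro!: image_eqI[of _ _ "Inf (S x)"])
  next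
    fix x assume "x \<in> \<phi> -` (h ` ({0..1} \<inter> {..a}))"
    then obtain t where "t \<in> S x" "t \<le> a" by (auto simp: S_def)
    then show "x \<in> {x. Inf (S x) \<le> a}" using cInf_lower[OF _ bb, of t x] by auto
  qed
  show ?thesis
  proof (rule that[of "\<lambda>x. Inf (S x)"])
    show "(\<lambda>x. Inf (S x)) \<in> borel_measurable borel"
      unfolding borel_measurable_iff_le
    proof
      fix a
      have "compact (h ` ({0..1} \<inter> {..a}))"
        using h by (intro compact_continuous_image compact_Int_closed) (auto intro: continuous_on_subset)
      then have "closed (\<phi> -` (h ` ({0..1} \<inter> {..a})))"
        by (intro closed_vimage compact_imp_closed \<phi>)
      then show "{w \<in> space borel. Inf (S w) \<le> a} \<in> sets borel" by (simp add: le_iff)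
    qed
    show "Inf (S x) \<in> {0..1}" "h (Inf (S x)) = \<phi> x" for x
      using Inf_in[of x] unfolding S_def by blast+
  qed
qed

section \<open>Almost sure representation in Euclidean space\<close>

text \<open>Weak convergence in the form of almost sure convergence on one probability space. The
  sample space is \<open>real\<close> because Skorohod's theorem on the line delivers it
  there.\<close>

definition skorohod_representation ::
    "(nat \<Rightarrow> 'a::euclidean_space measure) \<Rightarrow> 'a measure \<Rightarrow> real measure \<Rightarrow> (nat \<Rightarrow> real \<Rightarrow> 'a) \<Rightarrow> (real \<Rightarrow> 'a) \<Rightarrow> bool" where
  "skorohod_representation \<mu> \<rho> \<Omega> X Y \<longleftrightarrow> prob_space \<Omega> \<and>
     (\<forall>n. X n \<in> borel_measurable \<Omega> \<and> distr \<Omega> borel (X n) = \<mu> n) \<and>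
     Y \<in> borel_measurable \<Omega> \<and> distr \<Omega> borel Y = \<rho> \<and>
     (AE w in \<Omega>. (\<lambda>n. X n w) \<longlonglongrightarrow> Y w)"

lemma skorohod_representation_subseq:
  "skorohod_representation \<mu> \<rho> \<Omega> X Y \<Longrightarrow> strict_mono r \<Longrightarrow>
    skorohod_representation (\<mu> \<circ> r) \<rho> \<Omega> (X \<circ> r) Y"
  unfolding skorohod_representation_def
  by (auto elim!: eventually_mono dest: LIMSEQ_subseq_LIMSEQ simp: comp_def)

text \<open>The map z / (1 - |z|) from the open unit ball to the whole space blows up at the sphere,
  so a limit point on the sphere would force the liminf to be infinite.\<close>

lemma norm_limit_less_one:
  fixes z :: "nat \<Rightarrow> 'a::real_normed_vector"
  assumes z: "\<And>n. norm (z n) < 1" "z \<longlonglongrightarrow> l"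
    and fin: "liminf (\<lambda>n. ennreal ((norm (z n /\<^sub>R (1 - norm (z n))))\<^sup>2)) \<noteq> \<infinity>"
  shows "norm l < 1"
proof (rule ccontr)
  assume "\<not> norm l < 1"
  obtain q where q: "0 \<le> q" "liminf (\<lambda>n. ennreal ((norm (z n /\<^sub>R (1 - norm (z n))))\<^sup>2)) = ennreal q"
    using fin by (cases "liminf (\<lambda>n. ennreal ((norm (z n /\<^sub>R (1 - norm (z n))))\<^sup>2))") auto
  \<comment> \<open>Any number above \<open>sqrt q\<close> contradicts the liminf, and the image
    norm exceeds K exactly when \<open>norm (z n)\<close> exceeds
    \<open>K / (1 + K)\<close>.\<close>
  define K where "K = sqrt q + 1"
  have "K\<^sup>2 = q + 2 * sqrt q + 1" using q(1) by (simp add: K_def power2_sum)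
  then have K: "K > 0" "q < K\<^sup>2" using real_sqrt_ge_zero[OF q(1)] unfolding K_def by linarith+
  have "K / (1 + K) < 1" using K by simp
  then have "eventually (\<lambda>n. K / (1 + K) < norm (z n)) sequentially"
    using \<open>\<not> norm l < 1\<close> by (intro order_tendstoD[OF tendsto_norm[OF z(2)]]) simp
  then have "eventually (\<lambda>n. ennreal (K\<^sup>2) \<le> ennreal ((norm (z n /\<^sub>R (1 - norm (z n))))\<^sup>2)) sequentially"
  proof eventually_elim
    fix n assume "K / (1 + K) < norm (z n)"
    then have "K \<le> norm (z n) / (1 - norm (z n))" using z(1)[of n] K by (simp add: field_simps)
    then have "K \<le> norm (z n /\<^sub>R (1 - norm (z n)))" using z(1)[of n] by (simp add: divide_inverse mult.commute)
    then show "ennreal (K\<^sup>2) \<le> ennreal ((norm (z n /\<^sub>R (1 - norm (z n))))\<^sup>2)"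
      using K by (intro ennreal_leI power_mono) auto
  qed
  then have "ennreal (K\<^sup>2) \<le> ennreal q" unfolding q(2)[symmetric] by (rule Liminf_bounded)
  then show False using K q(1) by (simp add: ennreal_le_iff)
qed

text \<open>A space-filling curve transports Helly's selection theorem and Skorohod's theorem from the
  line to Euclidean space; the space is first mapped onto the open unit ball, and
  Fatou's lemma shows that no mass escapes to the unit sphere.\<close>

theorem skorohod_representation_exists:
  fixes \<nu> :: "nat \<Rightarrow> 'a::euclidean_space measure"
  assumes prob: "\<And>n. prob_space (\<nu> n)" and sets[measurable_cong]: "\<And>n. sets (\<nu> n) = sets borel"
    and bnd: "\<And>n. (\<integral>\<^sup>+ x. ennreal ((norm x)\<^sup>2) \<partial>\<nu> n) \<le> C" and C: "C < \<infinity>"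
  shows "\<exists>r \<rho> \<Omega> X Y. strict_mono r \<and> skorohod_representation (\<nu> \<circ> r) \<rho> \<Omega> X Y"
proof -
  obtain h :: "real \<Rightarrow> 'a" where h: "continuous_on UNIV h" "ball 0 1 \<subseteq> h ` {0..1}"
    by (rule space_filling_curve)
  define \<phi> :: "'a \<Rightarrow> 'a" where "\<phi> x = x /\<^sub>R (1 + norm x)" for x
  define \<psi> :: "'a \<Rightarrow> 'a" where "\<psi> x = x /\<^sub>R (1 - norm x)" for x
  have pos: "1 + norm x > 0" for x :: 'a using norm_ge_zero[of x] by linarith
  have norm_\<phi>: "norm (\<phi> x) < 1" for x
    using pos[of x] by (simp add: \<phi>_def field_simps)
  have \<psi>\<phi>: "\<psi> (\<phi> x) = x" for x
  proof -
    have "1 - norm (\<phi> x) = 1 / (1 + norm x)" using pos[of x] by (simp add: \<phi>_def field_simps)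
    then show ?thesis using pos[of x] by (simp add: \<psi>_def \<phi>_def)
  qed
  have "continuous_on UNIV \<phi>" unfolding \<phi>_def
    using pos by (intro continuous_intros) (metis less_irrefl)
  moreover have "range \<phi> \<subseteq> h ` {0..1}" using norm_\<phi> h(2) by (auto simp: subset_iff)
  ultimately obtain s where s[measurable]: "s \<in> borel_measurable borel"
    and s01: "\<And>x. s x \<in> {0..1}" and hs: "\<And>x. h (s x) = \<phi> x"
    using Borel_section_compact[OF h(1)] by metis
  have h_meas[measurable]: "h \<in> borel_measurable borel"
    using h(1) by (rule borel_measurable_continuous_onI)
  have \<psi>_meas[measurable]: "\<psi> \<in> borel_measurable borel" unfolding \<psi>_def by measurable
  define L where "L n = distr (\<nu> n) borel s" for n
  have L: "real_distribution (L n)" for n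
    unfolding L_def using prob[of n] by (intro prob_space.real_distribution_distr) simp_all
  have "tight L" unfolding tight_def
  proof (intro conjI allI impI L)
    fix \<epsilon> :: real assume "\<epsilon> > 0"
    \<comment> \<open>The laws live on [0,1], so tightness comes for free; the interval is open on
      the left and must contain 0.\<close>
    have "measure (L n) {-1<..1} = 1" for n
    proof -
      have "-1 < s x" "s x \<le> 1" for x using s01[of x] by auto
      then have "s -` {-1<..1} \<inter> space (\<nu> n) = space (\<nu> n)"
        by auto
      then show ?thesis using prob_space.prob_space[OF prob[of n]]
        unfolding L_def by (subst measure_distr) simp_all
    qed
    then show "\<exists>a b. a < b \<and> (\<forall>n. measure (L n) {a<..b} > 1 - \<epsilon>)"
      using \<open>\<epsilon> > 0\<close> by (intro exI[of _ "-1"] exI[of _ 1]) auto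
  qed
  then obtain r M where r: "strict_mono (r :: nat \<Rightarrow> nat)" and M: "real_distribution M" "weak_conv_m (L \<circ> id \<circ> r) M"
    using tight_imp_convergent_subsubsequence[OF _ strict_mono_id] by blast
  have "weak_conv_m (\<lambda>n. L (r n)) M" using M(2) by (simp add: comp_def)
  from Skorohod[OF L M(1) this]
  obtain \<Omega> :: "real measure" and T T' where \<Omega>: "prob_space \<Omega>"
    and T[measurable]: "\<And>n. T n \<in> borel_measurable \<Omega>" and T_law: "\<And>n. distr \<Omega> borel (T n) = L (r n)"
    and T': "T' \<in> measurable \<Omega> lborel" and lim: "\<And>w. w \<in> space \<Omega> \<Longrightarrow> (\<lambda>n. T n w) \<longlonglongrightarrow> T' w"
    by blast
  have T'm[measurable]: "T' \<in> borel_measurable \<Omega>" using T' by simp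
  \<comment> \<open>On the range of \<open>s\<close> the map \<open>\<psi> \<circ> h\<close> inverts
    \<open>s\<close>, since \<open>h (s x) = \<phi> x\<close>; this is what brings back the laws
    \<open>\<nu> (r n)\<close>.\<close>
  define X where "X n w = \<psi> (h (T n w))" for n w
  define Y where "Y w = \<psi> (h (T' w))" for w
  have X[measurable]: "X n \<in> borel_measurable \<Omega>" for n unfolding X_def by measurable
  have Y[measurable]: "Y \<in> borel_measurable \<Omega>" unfolding Y_def by measurable
  have law: "distr \<Omega> borel (X n) = \<nu> (r n)" for n
  proof -
    have "distr \<Omega> borel (X n) = distr (distr \<Omega> borel (T n)) borel (\<lambda>x. \<psi> (h x))"
      by (subst distr_distr) (simp_all add: comp_def X_def[abs_def])
    also have "\<dots> = distr (\<nu> (r n)) borel (\<lambda>x. \<psi> (h (s x)))"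
      unfolding T_law L_def by (subst distr_distr) (simp_all add: comp_def)
    also have "\<dots> = \<nu> (r n)" by (simp add: hs \<psi>\<phi> distr_id2 sets)
    finally show ?thesis .
  qed
  \<comment> \<open>The curve may leave the open ball, but the law of \<open>T n\<close> is an image
    under \<open>s\<close>, and \<open>h (s x) = \<phi> x\<close> lies in the ball.\<close>
  have small: "AE w in \<Omega>. \<forall>n. norm (h (T n w)) < 1"
  proof (subst AE_all_countable, intro allI)
    fix n
    have "AE x in \<nu> (r n). norm (h (s x)) < 1" using norm_\<phi> by (simp add: hs)
    then have "AE t in distr \<Omega> borel (T n). norm (h t) < 1"
      unfolding T_law L_def by (subst AE_distr_iff) simp_all
    then show "AE w in \<Omega>. norm (h (T n w)) < 1" by (subst (asm) AE_distr_iff) simp_all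
  qed
  have "(\<integral>\<^sup>+ w. liminf (\<lambda>n. ennreal ((norm (X n w))\<^sup>2)) \<partial>\<Omega>) \<le> liminf (\<lambda>n. \<integral>\<^sup>+ w. ennreal ((norm (X n w))\<^sup>2) \<partial>\<Omega>)"
    by (intro nn_integral_liminf) simp
  also have "\<dots> \<le> C"
  proof -
    have "(\<integral>\<^sup>+ w. ennreal ((norm (X n w))\<^sup>2) \<partial>\<Omega>) = (\<integral>\<^sup>+ x. ennreal ((norm x)\<^sup>2) \<partial>\<nu> (r n))" for n
      unfolding law[symmetric] by (subst nn_integral_distr) simp_all
    then show ?thesis using bnd by (intro Liminf_le) simp_all
  qed
  finally have "(\<integral>\<^sup>+ w. liminf (\<lambda>n. ennreal ((norm (X n w))\<^sup>2)) \<partial>\<Omega>) \<noteq> \<infinity>"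
    using C by (auto simp: top_unique)
  then have "AE w in \<Omega>. liminf (\<lambda>n. ennreal ((norm (X n w))\<^sup>2)) \<noteq> \<infinity>"
    by (intro nn_integral_PInf_AE) measurable
  with small AE_space have "AE w in \<Omega>. (\<lambda>n. X n w) \<longlonglongrightarrow> Y w"
  proof eventually_elim
    fix w assume w: "\<forall>n. norm (h (T n w)) < 1" "w \<in> space \<Omega>" "liminf (\<lambda>n. ennreal ((norm (X n w))\<^sup>2)) \<noteq> \<infinity>"
    have ht: "(\<lambda>n. h (T n w)) \<longlonglongrightarrow> h (T' w)"
      using lim[OF w(2)] h(1) by (auto simp: continuous_on_eq_continuous_at intro: isCont_tendsto_compose)
    have "norm (h (T' w)) < 1"
      using w by (intro norm_limit_less_one[OF _ ht]) (auto simp: X_def \<psi>_def)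
    then show "(\<lambda>n. X n w) \<longlonglongrightarrow> Y w" unfolding X_def Y_def \<psi>_def by (intro tendsto_intros ht) auto
  qed
  then have "skorohod_representation (\<nu> \<circ> r) (distr \<Omega> borel Y) \<Omega> X Y"
    using \<Omega> law unfolding skorohod_representation_def by simp
  then show ?thesis using r by blast
qed

section \<open>The quadratic Wasserstein distance\<close>

text \<open>Fatou's lemma for real integrals. The eventual bound replaces a liminf of the integrals,
  which could be infinite, and lets the applications pick or compare individual indices.\<close>

lemma integral_Fatou_eventually:
  fixes f :: "nat \<Rightarrow> 'a \<Rightarrow> real"
  assumes f: "\<And>n. integrable M (f n)" "\<And>n. AE x in M. 0 \<le> f n x"
    and g: "integrable M g" "AE x in M. (\<lambda>n. f n x) \<longlonglongrightarrow> g x" and e: "0 < e"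
  shows "\<forall>\<^sub>F n in sequentially. integral\<^sup>L M g - e < integral\<^sup>L M (f n)"
proof -
  have "AE x in M. \<forall>n. 0 \<le> f n x" using f(2) by (simp add: AE_all_countable)
  with g(2) have AE: "AE x in M. 0 \<le> g x \<and> liminf (\<lambda>n. ennreal (f n x)) = ennreal (g x)"
  proof eventually_elim
    fix x assume lim: "(\<lambda>n. f n x) \<longlonglongrightarrow> g x" and pos: "\<forall>n. 0 \<le> f n x"
    have "0 \<le> g x" by (rule LIMSEQ_le_const[OF lim]) (use pos in auto)
    then show "0 \<le> g x \<and> liminf (\<lambda>n. ennreal (f n x)) = ennreal (g x)"
      using lim by (intro conjI lim_imp_Liminf tendsto_ennrealI) auto
  qed
  have [measurable]: "f n \<in> borel_measurable M" for n using f(1) by (rule borel_measurable_integrable)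
  have g0: "AE x in M. 0 \<le> g x" using AE by (elim eventually_mono) simp
  have "ennreal (integral\<^sup>L M g) = (\<integral>\<^sup>+x. ennreal (g x) \<partial>M)"
    by (rule nn_integral_eq_integral[OF g(1) g0, symmetric])
  also have "\<dots> = (\<integral>\<^sup>+x. liminf (\<lambda>n. ennreal (f n x)) \<partial>M)"
    using AE by (intro nn_integral_cong_AE) (auto elim: eventually_mono)
  also have "\<dots> \<le> liminf (\<lambda>n. \<integral>\<^sup>+x. ennreal (f n x) \<partial>M)" by (intro nn_integral_liminf) simp
  also have "(\<lambda>n. \<integral>\<^sup>+x. ennreal (f n x) \<partial>M) = (\<lambda>n. ennreal (integral\<^sup>L M (f n)))"
    using nn_integral_eq_integral[OF f] by simp
  finally have le: "ennreal (integral\<^sup>L M g) \<le> liminf (\<lambda>n. ennreal (integral\<^sup>L M (f n)))" .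
  have nn: "0 \<le> integral\<^sup>L M (f n)" for n using f(2) by (rule integral_nonneg_AE)
  show ?thesis
  \<comment> \<open>In \<open>ennreal\<close> the number \<open>integral\<^sup>L M g - e\<close> is
    cut off at 0, so the strict comparison below is available only when the integral is
    positive.\<close>
  proof (cases "integral\<^sup>L M g = 0")
    case True
    then show ?thesis using nn e by (intro always_eventually allI) (metis diff_0 less_le_trans neg_less_0_iff_less)
  next
    case False
    then have "0 < integral\<^sup>L M g" using integral_nonneg_AE[OF g0] by simp
    then have "ennreal (integral\<^sup>L M g - e) < ennreal (integral\<^sup>L M g)" using e by (intro ennreal_lessI) auto
    then have "\<forall>\<^sub>F n in sequentially. ennreal (integral\<^sup>L M g - e) < ennreal (integral\<^sup>L M (f n))"
      using le by (intro less_LiminfD) (rule less_le_trans)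
    then show ?thesis by (rule eventually_mono) (use nn in \<open>auto simp: ennreal_less_iff intro: ennreal_less_iff[THEN iffD1] simp flip: not_le dest: ennreal_leI\<close>)
  qed
qed

text \<open>Dominated convergence transfers integrals of bounded continuous functions to the limits.
  Indicators of closed sets are pointwise limits of such functions of the distance, and closed sets
  form an intersection-stable generator of the Borel sets.\<close>

lemma limit_law_unique:
  fixes X X' :: "nat \<Rightarrow> _ \<Rightarrow> 'a::euclidean_space"
  assumes M: "prob_space M" and N: "prob_space N"
    and X[measurable]: "\<And>n. X n \<in> borel_measurable M" and Y[measurable]: "Y \<in> borel_measurable M"
    and X'[measurable]: "\<And>n. X' n \<in> borel_measurable N" and Y'[measurable]: "Y' \<in> borel_measurable N"
    and lim: "AE w in M. (\<lambda>n. X n w) \<longlonglongrightarrow> Y w" and lim': "AE w in N. (\<lambda>n. X' n w) \<longlonglongrightarrow> Y' w"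
    and eq: "\<And>n. distr M borel (X n) = distr N borel (X' n)"
  shows "distr M borel Y = distr N borel Y'"
proof -
  interpret M: prob_space M by fact
  interpret N: prob_space N by fact
  have integral_eq: "(\<integral>w. f (Y w) \<partial>M) = (\<integral>w. f (Y' w) \<partial>N)"
    if f: "continuous_on UNIV f" and b: "\<And>x. norm (f x) \<le> 1" for f :: "'a \<Rightarrow> real"
  proof (rule LIMSEQ_unique)
    have [measurable]: "f \<in> borel_measurable borel" using f by (rule borel_measurable_continuous_onI)
    have isc: "isCont f x" for x using f by (simp add: continuous_on_eq_continuous_at)
    show "(\<lambda>n. \<integral>w. f (X n w) \<partial>M) \<longlonglongrightarrow> (\<integral>w. f (Y w) \<partial>M)"
      using lim by (intro integral_dominated_convergence[where w = "\<lambda>_. 1"])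
        (auto simp: b[unfolded real_norm_def] elim!: eventually_mono intro: isCont_tendsto_compose[OF isc])
    have "(\<integral>w. f (X n w) \<partial>M) = (\<integral>w. f (X' n w) \<partial>N)" for n
      using arg_cong[OF eq[of n], of "\<lambda>L. integral\<^sup>L L f"] by (simp add: integral_distr)
    moreover have "(\<lambda>n. \<integral>w. f (X' n w) \<partial>N) \<longlonglongrightarrow> (\<integral>w. f (Y' w) \<partial>N)"
      using lim' by (intro integral_dominated_convergence[where w = "\<lambda>_. 1"])
        (auto simp: b[unfolded real_norm_def] elim!: eventually_mono intro: isCont_tendsto_compose[OF isc])
    ultimately show "(\<lambda>n. \<integral>w. f (X n w) \<partial>M) \<longlonglongrightarrow> (\<integral>w. f (Y' w) \<partial>N)" by simp
  qed
  interpret DM: prob_space "distr M borel Y" by (rule M.prob_space_distr) simp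
  interpret DN: prob_space "distr N borel Y'" by (rule N.prob_space_distr) simp
  have closed_eq: "emeasure (distr M borel Y) F = emeasure (distr N borel Y') F" if F: "closed F" for F
  \<comment> \<open>The empty set is split off because \<open>infdist x {} = 0\<close> by
    convention, which would make every \<open>f k\<close> constantly 1.\<close>
  proof (cases "F = {}")
    case False
    define f where "f k x = max 0 (1 - real k * infdist x F)" for k x
    have cont: "continuous_on UNIV (f k)" for k unfolding f_def by (intro continuous_intros)
    have bd: "norm (f k x) \<le> 1" for k x
      using infdist_nonneg[of x F] by (simp add: f_def)
    have [measurable]: "f k \<in> borel_measurable borel" for k using cont by (rule borel_measurable_continuous_onI)
    have [measurable]: "F \<in> sets borel" using F by simp
    have lim_f: "(\<lambda>k. f k x) \<longlonglongrightarrow> indicator F x" for x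
    proof (cases "x \<in> F")
      case True
      then show ?thesis by (simp add: f_def)
    next
      case out: False
      then have d: "infdist x F > 0" using F False infdist_pos_not_in_closed by blast
      obtain k0 where k0: "real k0 * infdist x F > 1" using ex_less_of_nat_mult[OF d] by auto
      have "f k x = 0" if "k \<ge> k0" for k
      proof -
        have "real k0 * infdist x F \<le> real k * infdist x F" using that d by (intro mult_right_mono) auto
        then show ?thesis using k0 by (simp add: f_def)
      qed
      then show ?thesis using out by (auto intro!: tendsto_eventually eventually_sequentiallyI[of k0])
    qed
    have conv: "(\<lambda>k. \<integral>w. f k (U w) \<partial>K) \<longlonglongrightarrow> measure (distr K borel U) F"
      if K: "prob_space K" and U[measurable]: "U \<in> borel_measurable K" for K U
    proof -
      interpret K: prob_space K by fact
      have "(\<lambda>k. \<integral>w. f k (U w) \<partial>K) \<longlonglongrightarrow> (\<integral>w. indicat_real F (U w) \<partial>K)"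
        by (intro integral_dominated_convergence[where w = "\<lambda>_. 1"]) (auto simp: bd[unfolded real_norm_def] lim_f)
      also have "(\<integral>w. indicat_real F (U w) \<partial>K) = (\<integral>x. indicat_real F x \<partial>distr K borel U)"
        by (subst integral_distr) simp_all
      also have "\<dots> = measure (distr K borel U) F" by simp
      finally show ?thesis .
    qed
    have "(\<lambda>k. \<integral>w. f k (Y w) \<partial>M) = (\<lambda>k. \<integral>w. f k (Y' w) \<partial>N)"
      by (intro ext integral_eq cont bd)
    then have "measure (distr M borel Y) F = measure (distr N borel Y') F"
      using conv[OF M Y] conv[OF N Y'] by (simp add: LIMSEQ_unique)
    then show ?thesis by (simp add: DM.emeasure_eq_measure DN.emeasure_eq_measure)
  qed simp
  show ?thesis
  proof (rule measure_eqI_generator_eq[where E = "Collect closed" and \<Omega> = UNIV and A = "\<lambda>_. UNIV"])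
    show "Int_stable (Collect closed)" by (auto simp: Int_stable_def)
    show "sets (distr M borel Y) = sigma_sets UNIV (Collect closed)" "sets (distr N borel Y') = sigma_sets UNIV (Collect closed)"
      by (simp_all add: borel_eq_closed)
    show "emeasure (distr M borel Y) UNIV \<noteq> \<infinity>" for i :: nat by simp
  qed (use closed_eq in auto)
qed

lemma skorohod_representation_unique:
  "skorohod_representation \<mu> \<rho> \<Omega> X Y \<Longrightarrow> skorohod_representation \<mu> \<rho>' \<Omega>' X' Y' \<Longrightarrow> \<rho> = \<rho>'"
  unfolding skorohod_representation_def
  by (metis limit_law_unique[of \<Omega> \<Omega>' X Y X' Y'])

section \<open>Second moments and square-integrable random variables\<close>

definition second_moment :: "'a::euclidean_space measure \<Rightarrow> real" where
  "second_moment \<mu> = (\<integral>x. (norm x)\<^sup>2 \<partial>\<mu>)"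

lemma P2D:
  assumes "\<mu> \<in> P2"
  shows "prob_space \<mu>" "sets \<mu> = sets borel" "integrable \<mu> (\<lambda>x. (norm x)\<^sup>2)"
    "(\<integral>\<^sup>+ x. ennreal ((norm x)\<^sup>2) \<partial>\<mu>) = ennreal (second_moment \<mu>)"
proof -
  show p: "prob_space \<mu>" and [measurable_cong]: "sets \<mu> = sets borel" using assms by (auto simp: P2_def)
  have "(\<integral>\<^sup>+ x. ennreal ((norm x)\<^sup>2) \<partial>\<mu>) < \<infinity>" using assms by (simp add: P2_def)
  then show "integrable \<mu> (\<lambda>x. (norm x)\<^sup>2)"
    by (intro integrableI_nonneg) auto
  then show "(\<integral>\<^sup>+ x. ennreal ((norm x)\<^sup>2) \<partial>\<mu>) = ennreal (second_moment \<mu>)"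
    unfolding second_moment_def by (intro nn_integral_eq_integral) auto
qed

lemma distr_in_P2_iff:
  assumes "prob_space \<Omega>" and [measurable]: "X \<in> borel_measurable \<Omega>"
  shows "distr \<Omega> borel X \<in> P2 \<longleftrightarrow> integrable \<Omega> (\<lambda>w. (norm (X w))\<^sup>2)"
proof -
  have "distr \<Omega> borel X \<in> P2 \<longleftrightarrow> (\<integral>\<^sup>+ w. ennreal ((norm (X w))\<^sup>2) \<partial>\<Omega>) < \<infinity>"
    using assms by (simp add: P2_def prob_space.prob_space_distr nn_integral_distr)
  also have "\<dots> \<longleftrightarrow> integrable \<Omega> (\<lambda>w. (norm (X w))\<^sup>2)" by (simp add: integrable_iff_bounded)
  finally show ?thesis .
qed

lemma second_moment_distr:
  "X \<in> borel_measurable \<Omega> \<Longrightarrow> second_moment (distr \<Omega> borel X) = (\<integral>w. (norm (X w))\<^sup>2 \<partial>\<Omega>)"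
  unfolding second_moment_def by (subst integral_distr) simp_all

lemma square_integrable_inner:
  fixes X Y :: "'b \<Rightarrow> 'a::euclidean_space"
  assumes [measurable]: "X \<in> borel_measurable M" "Y \<in> borel_measurable M"
    and i: "integrable M (\<lambda>w. (norm (X w))\<^sup>2)" "integrable M (\<lambda>w. (norm (Y w))\<^sup>2)"
  shows "integrable M (\<lambda>w. X w \<bullet> Y w)"
proof (rule Bochner_Integration.integrable_bound[OF Bochner_Integration.integrable_add[OF i]])
  show "AE w in M. norm (X w \<bullet> Y w) \<le> norm ((norm (X w))\<^sup>2 + (norm (Y w))\<^sup>2)"
  proof (intro AE_I2)
    fix w
    have "norm (X w \<bullet> Y w) \<le> norm (X w) * norm (Y w)" by (simp add: Cauchy_Schwarz_ineq2)
    also have "\<dots> \<le> (norm (X w))\<^sup>2 + (norm (Y w))\<^sup>2"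
      using sum_squares_bound[of "norm (X w)" "norm (Y w)"]
        mult_nonneg_nonneg[OF norm_ge_zero[of "X w"] norm_ge_zero[of "Y w"]] by linarith
    finally show "norm (X w \<bullet> Y w) \<le> norm ((norm (X w))\<^sup>2 + (norm (Y w))\<^sup>2)" by simp
  qed
qed simp

lemma norm_diff_sq: "(norm (x - y))\<^sup>2 = (norm x)\<^sup>2 + (norm y)\<^sup>2 - 2 * (x \<bullet> y)"
  for x y :: "'a::real_inner"
  by (simp add: power2_norm_eq_inner inner_diff inner_commute)

lemma square_integrable_diff:
  fixes X Y :: "'b \<Rightarrow> 'a::euclidean_space"
  assumes "X \<in> borel_measurable M" "Y \<in> borel_measurable M"
    and "integrable M (\<lambda>w. (norm (X w))\<^sup>2)" "integrable M (\<lambda>w. (norm (Y w))\<^sup>2)"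
  shows "integrable M (\<lambda>w. (norm (X w - Y w))\<^sup>2)"
  unfolding norm_diff_sq
  using assms square_integrable_inner[OF assms] by simp

section \<open>Couplings and the quadratic transport cost\<close>

lemma fst_borel_measurable [measurable]:
  "(fst :: 'a::euclidean_space \<times> 'b::euclidean_space \<Rightarrow> 'a) \<in> borel_measurable borel"
  by (intro borel_measurable_continuous_onI continuous_on_fst continuous_on_id)

lemma snd_borel_measurable [measurable]:
  "(snd :: 'a::euclidean_space \<times> 'b::euclidean_space \<Rightarrow> 'b) \<in> borel_measurable borel"
  by (intro borel_measurable_continuous_onI continuous_on_snd continuous_on_id)

lemma couplings_distr:
  assumes "prob_space \<Omega>" and [measurable]: "X \<in> borel_measurable \<Omega>" "Y \<in> borel_measurable \<Omega>"
  shows "distr \<Omega> borel (\<lambda>w. (X w, Y w)) \<in> couplings (distr \<Omega> borel X) (distr \<Omega> borel Y)"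
  using assms unfolding couplings_def
  by (simp add: prob_space.prob_space_distr distr_distr comp_def)

lemma transport_cost_distr:
  assumes [measurable]: "X \<in> borel_measurable \<Omega>" "Y \<in> borel_measurable \<Omega>"
  shows "transport_cost p (distr \<Omega> borel (\<lambda>w. (X w, Y w))) = (\<integral>\<^sup>+ w. ennreal (norm (X w - Y w) powr p) \<partial>\<Omega>)"
  unfolding transport_cost_def by (subst nn_integral_distr) simp_all

lemma transport_cost_2: "transport_cost 2 \<gamma> = (\<integral>\<^sup>+ z. ennreal ((norm (fst z - snd z))\<^sup>2) \<partial>\<gamma>)"
  unfolding transport_cost_def by simp

lemma couplingsD:
  assumes "\<gamma> \<in> couplings \<mu> \<nu>"
  shows "prob_space \<gamma>" "sets \<gamma> = sets borel" "fst \<in> borel_measurable \<gamma>" "snd \<in> borel_measurable \<gamma>"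
    "distr \<gamma> borel fst = \<mu>" "distr \<gamma> borel snd = \<nu>"
proof -
  show s: "sets \<gamma> = sets borel" using assms by (simp add: couplings_def)
  show "fst \<in> borel_measurable \<gamma>" "snd \<in> borel_measurable \<gamma>"
    unfolding measurable_cong_sets[OF s refl] by measurable
qed (use assms in \<open>simp_all add: couplings_def\<close>)

lemma couplings_square_integrable:
  assumes "\<gamma> \<in> couplings \<mu> \<nu>" "\<mu> \<in> P2" "\<nu> \<in> P2"
  shows "integrable \<gamma> (\<lambda>z. (norm (fst z))\<^sup>2)" "integrable \<gamma> (\<lambda>z. (norm (snd z))\<^sup>2)"
    "integrable \<gamma> (\<lambda>z. (norm (fst z - snd z))\<^sup>2)"
    "transport_cost 2 \<gamma> = ennreal (\<integral>z. (norm (fst z - snd z))\<^sup>2 \<partial>\<gamma>)"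
proof -
  note c = couplingsD[OF assms(1)]
  show 1: "integrable \<gamma> (\<lambda>z. (norm (fst z))\<^sup>2)" using distr_in_P2_iff[OF c(1,3)] c(5) assms(2) by simp
  show 2: "integrable \<gamma> (\<lambda>z. (norm (snd z))\<^sup>2)" using distr_in_P2_iff[OF c(1,4)] c(6) assms(3) by simp
  show 3: "integrable \<gamma> (\<lambda>z. (norm (fst z - snd z))\<^sup>2)" by (rule square_integrable_diff[OF c(3,4) 1 2])
  show "transport_cost 2 \<gamma> = ennreal (\<integral>z. (norm (fst z - snd z))\<^sup>2 \<partial>\<gamma>)"
    unfolding transport_cost_2 by (rule nn_integral_eq_integral[OF 3]) simp
qed

text \<open>Supplies a coupling of finite quadratic cost, so that the infimum is finite and
  \<open>enn2real\<close> does not collapse it to 0.\<close>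

lemma product_coupling:
  assumes "\<mu> \<in> P2" "\<nu> \<in> P2"
  shows "\<mu> \<Otimes>\<^sub>M \<nu> \<in> couplings \<mu> \<nu>"
proof -
  note m = P2D[OF assms(1)] and n = P2D[OF assms(2)]
  interpret m: prob_space \<mu> by fact
  interpret n: prob_space \<nu> by fact
  interpret pair_prob_space \<mu> \<nu> ..
  have s: "sets (\<mu> \<Otimes>\<^sub>M \<nu>) = sets borel"
    using sets_pair_measure_cong[OF m(2) n(2)] by (simp only: borel_prod)
  have "distr (\<mu> \<Otimes>\<^sub>M \<nu>) \<mu> fst = \<mu>" by (rule n.distr_pair_fst)
  moreover have "distr (\<mu> \<Otimes>\<^sub>M \<nu>) \<nu> snd = \<nu>"
  proof (rule measure_eqI)
    fix A assume A: "A \<in> sets (distr (\<mu> \<Otimes>\<^sub>M \<nu>) \<nu> snd)"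
    then have "snd -` A \<inter> space (\<mu> \<Otimes>\<^sub>M \<nu>) = space \<mu> \<times> A"
      by (auto simp: space_pair_measure dest: sets.sets_into_space)
    moreover have "emeasure (distr (\<mu> \<Otimes>\<^sub>M \<nu>) \<nu> snd) A = emeasure (\<mu> \<Otimes>\<^sub>M \<nu>) (snd -` A \<inter> space (\<mu> \<Otimes>\<^sub>M \<nu>))"
      using A by (intro emeasure_distr) simp_all
    ultimately show "emeasure (distr (\<mu> \<Otimes>\<^sub>M \<nu>) \<nu> snd) A = emeasure \<nu> A"
      using A n.emeasure_pair_measure_Times[of "space \<mu>" \<mu> A] by (simp add: m.emeasure_space_1)
  qed simp
  moreover have "distr (\<mu> \<Otimes>\<^sub>M \<nu>) borel fst = distr (\<mu> \<Otimes>\<^sub>M \<nu>) \<mu> fst"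
    "distr (\<mu> \<Otimes>\<^sub>M \<nu>) borel snd = distr (\<mu> \<Otimes>\<^sub>M \<nu>) \<nu> snd"
    by (rule distr_cong[OF refl m(2)[symmetric] refl], rule distr_cong[OF refl n(2)[symmetric] refl])
  ultimately show ?thesis
    using s prob_space_axioms by (simp add: couplings_def)
qed

lemma Wasserstein_2_square: "(Wasserstein 2 \<mu> \<nu>)\<^sup>2 = enn2real (INF \<gamma>\<in>couplings \<mu> \<nu>. transport_cost 2 \<gamma>)"
  unfolding Wasserstein_def by (simp add: powr_half_sqrt)

lemma Wasserstein_nonneg [simp]: "0 \<le> Wasserstein p \<mu> \<nu>"
  unfolding Wasserstein_def by simp

lemma Wasserstein_2_le_coupling:
  assumes "\<gamma> \<in> couplings \<mu> \<nu>" "\<mu> \<in> P2" "\<nu> \<in> P2"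
  shows "(Wasserstein 2 \<mu> \<nu>)\<^sup>2 \<le> (\<integral>z. (norm (fst z - snd z))\<^sup>2 \<partial>\<gamma>)"
proof -
  have "(INF \<gamma>\<in>couplings \<mu> \<nu>. transport_cost 2 \<gamma>) \<le> ennreal (\<integral>z. (norm (fst z - snd z))\<^sup>2 \<partial>\<gamma>)"
    using couplings_square_integrable(4)[OF assms] assms(1) by (metis INF_lower)
  then show ?thesis
    unfolding Wasserstein_2_square by (simp add: enn2real_leI)
qed

lemma Wasserstein_2_le:
  assumes \<Omega>: "prob_space \<Omega>" and [measurable]: "X \<in> borel_measurable \<Omega>" "Y \<in> borel_measurable \<Omega>"
    and "distr \<Omega> borel X = \<mu>" "distr \<Omega> borel Y = \<nu>" "\<mu> \<in> P2" "\<nu> \<in> P2"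
  shows "(Wasserstein 2 \<mu> \<nu>)\<^sup>2 \<le> (\<integral>w. (norm (X w - Y w))\<^sup>2 \<partial>\<Omega>)"
proof -
  have "distr \<Omega> borel (\<lambda>w. (X w, Y w)) \<in> couplings \<mu> \<nu>"
    using couplings_distr[OF assms(1-3)] assms by simp
  then have "(Wasserstein 2 \<mu> \<nu>)\<^sup>2 \<le> (\<integral>z. (norm (fst z - snd z))\<^sup>2 \<partial>distr \<Omega> borel (\<lambda>w. (X w, Y w)))"
    using assms by (intro Wasserstein_2_le_coupling)
  also have "\<dots> = (\<integral>w. (norm (X w - Y w))\<^sup>2 \<partial>\<Omega>)" by (subst integral_distr) simp_all
  finally show ?thesis .
qed

text \<open>Almost optimal couplings come from finiteness of the infimum alone. Exactly optimal ones
  appear only where generalized geodesics supply them.\<close>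

lemma near_optimal_coupling:
  assumes "\<mu> \<in> P2" "\<nu> \<in> P2" "0 < e"
  shows "\<exists>\<gamma>\<in>couplings \<mu> \<nu>. (\<integral>z. (norm (fst z - snd z))\<^sup>2 \<partial>\<gamma>) < (Wasserstein 2 \<mu> \<nu>)\<^sup>2 + e"
proof -
  let ?I = "INF \<gamma>\<in>couplings \<mu> \<nu>. transport_cost 2 \<gamma>"
  have "?I \<le> transport_cost 2 (\<mu> \<Otimes>\<^sub>M \<nu>)" using product_coupling[OF assms(1,2)] by (rule INF_lower)
  then have "?I < \<infinity>"
    using couplings_square_integrable(4)[OF product_coupling[OF assms(1,2)] assms(1,2)]
    by (metis ennreal_less_top infinity_ennreal_def le_less_trans)
  then have I: "?I = ennreal ((Wasserstein 2 \<mu> \<nu>)\<^sup>2)" unfolding Wasserstein_2_square by simp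
  have "?I < ennreal ((Wasserstein 2 \<mu> \<nu>)\<^sup>2 + e)"
    unfolding I using assms(3) by (intro ennreal_lessI) (auto intro: add_nonneg_pos)
  then obtain \<gamma> where \<gamma>: "\<gamma> \<in> couplings \<mu> \<nu>" "transport_cost 2 \<gamma> < ennreal ((Wasserstein 2 \<mu> \<nu>)\<^sup>2 + e)"
    by (auto simp: INF_less_iff)
  then show ?thesis
    using couplings_square_integrable(4)[OF \<gamma>(1) assms(1,2)]
    by (intro bexI[OF _ \<gamma>(1)]) (simp add: ennreal_less_iff)
qed

lemma opt_couplings_cost:
  assumes "\<gamma> \<in> opt_couplings \<mu> \<nu>" "\<mu> \<in> P2" "\<nu> \<in> P2"
  shows "\<gamma> \<in> couplings \<mu> \<nu>" "(\<integral>z. (norm (fst z - snd z))\<^sup>2 \<partial>\<gamma>) = (Wasserstein 2 \<mu> \<nu>)\<^sup>2"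
proof -
  show \<gamma>: "\<gamma> \<in> couplings \<mu> \<nu>" using assms(1) by (simp add: opt_couplings_def is_arg_min_def)
  have "(INF \<gamma>\<in>couplings \<mu> \<nu>. transport_cost 2 \<gamma>) = transport_cost 2 \<gamma>"
  proof (rule antisym)
    show "transport_cost 2 \<gamma> \<le> (INF \<gamma>\<in>couplings \<mu> \<nu>. transport_cost 2 \<gamma>)"
      using assms(1) by (intro INF_greatest) (simp add: opt_couplings_def is_arg_min_def not_less)
  qed (rule INF_lower[OF \<gamma>])
  then show "(\<integral>z. (norm (fst z - snd z))\<^sup>2 \<partial>\<gamma>) = (Wasserstein 2 \<mu> \<nu>)\<^sup>2"
    unfolding Wasserstein_2_square couplings_square_integrable(4)[OF \<gamma> assms(2,3)] by simp
qed

lemma Wasserstein_2_commute: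
  assumes "\<mu> \<in> P2" "\<nu> \<in> P2"
  shows "Wasserstein 2 \<mu> \<nu> = Wasserstein 2 \<nu> \<mu>"
proof -
  have le: "(Wasserstein 2 \<mu> \<nu>)\<^sup>2 \<le> (Wasserstein 2 \<nu> \<mu>)\<^sup>2" if P: "\<mu> \<in> P2" "\<nu> \<in> P2" for \<mu> \<nu> :: "'a measure"
  proof (rule field_le_epsilon)
    fix e :: real assume "0 < e"
    then obtain \<gamma> where \<gamma>: "\<gamma> \<in> couplings \<nu> \<mu>" "(\<integral>z. (norm (fst z - snd z))\<^sup>2 \<partial>\<gamma>) < (Wasserstein 2 \<nu> \<mu>)\<^sup>2 + e"
      using near_optimal_coupling[OF P(2,1)] by blast
    note c = couplingsD[OF \<gamma>(1)]
    have "(Wasserstein 2 \<mu> \<nu>)\<^sup>2 \<le> (\<integral>z. (norm (snd z - fst z))\<^sup>2 \<partial>\<gamma>)"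
      by (rule Wasserstein_2_le[OF c(1,4,3,6,5) P])
    then show "(Wasserstein 2 \<mu> \<nu>)\<^sup>2 \<le> (Wasserstein 2 \<nu> \<mu>)\<^sup>2 + e"
      using \<gamma>(2) by (simp add: norm_minus_commute)
  qed
  show ?thesis
    by (intro antisym power2_le_imp_le[OF le[OF assms]] power2_le_imp_le[OF le[OF assms(2,1)]]) simp_all
qed

text \<open>Turns a bound on the distance to a fixed measure into the moment bound that compactness
  asks for. The factors 2 come from squaring the pointwise triangle inequality.\<close>

lemma second_moment_le:
  assumes "\<mu> \<in> P2" "\<nu> \<in> P2"
  shows "second_moment \<mu> \<le> 2 * (Wasserstein 2 \<mu> \<nu>)\<^sup>2 + 2 * second_moment \<nu>"
proof (rule field_le_epsilon)
  fix e :: real assume e: "0 < e"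
  then obtain \<gamma> where \<gamma>: "\<gamma> \<in> couplings \<mu> \<nu>" "(\<integral>z. (norm (fst z - snd z))\<^sup>2 \<partial>\<gamma>) < (Wasserstein 2 \<mu> \<nu>)\<^sup>2 + e / 2"
    using near_optimal_coupling[OF assms, of "e / 2"] by auto
  note c = couplingsD[OF \<gamma>(1)] and i = couplings_square_integrable[OF \<gamma>(1) assms]
  have "second_moment \<mu> = (\<integral>z. (norm (fst z))\<^sup>2 \<partial>\<gamma>)" using second_moment_distr[OF c(3)] c(5) by simp
  also have "\<dots> \<le> (\<integral>z. 2 * (norm (fst z - snd z))\<^sup>2 + 2 * (norm (snd z))\<^sup>2 \<partial>\<gamma>)"
  proof (intro integral_mono i Bochner_Integration.integrable_add integrable_mult_right)
    fix z :: "'a \<times> 'a"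
    have "(norm (fst z))\<^sup>2 \<le> (norm (fst z - snd z) + norm (snd z))\<^sup>2"
      using norm_triangle_sub[of "fst z" "snd z"] by (intro power_mono) (simp_all add: add.commute)
    also have "\<dots> \<le> 2 * (norm (fst z - snd z))\<^sup>2 + 2 * (norm (snd z))\<^sup>2"
      using sum_squares_bound[of "norm (fst z - snd z)" "norm (snd z)"] by (simp add: power2_sum)
    finally show "(norm (fst z))\<^sup>2 \<le> 2 * (norm (fst z - snd z))\<^sup>2 + 2 * (norm (snd z))\<^sup>2" .
  qed
  also have "\<dots> = 2 * (\<integral>z. (norm (fst z - snd z))\<^sup>2 \<partial>\<gamma>) + 2 * (\<integral>z. (norm (snd z))\<^sup>2 \<partial>\<gamma>)"
    using i by simp
  also have "(\<integral>z. (norm (snd z))\<^sup>2 \<partial>\<gamma>) = second_moment \<nu>" using second_moment_distr[OF c(4)] c(6) by simp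
  finally show "second_moment \<mu> \<le> 2 * (Wasserstein 2 \<mu> \<nu>)\<^sup>2 + 2 * second_moment \<nu> + e"
    using \<gamma>(2) by simp
qed

text \<open>Fatou's lemma: second moments can only drop in an almost sure limit.\<close>

lemma skorohod_representation_P2:
  assumes rep: "skorohod_representation \<mu> \<rho> \<Omega> X Y" and P: "\<And>n. \<mu> n \<in> P2" and C: "\<And>n. second_moment (\<mu> n) \<le> C"
  shows "\<rho> \<in> P2" "second_moment \<rho> \<le> C"
proof -
  have \<Omega>: "prob_space \<Omega>" and [measurable]: "X n \<in> borel_measurable \<Omega>" "Y \<in> borel_measurable \<Omega>"
    and law: "distr \<Omega> borel (X n) = \<mu> n" "distr \<Omega> borel Y = \<rho>"
    and lim: "AE w in \<Omega>. (\<lambda>n. X n w) \<longlonglongrightarrow> Y w" for n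
    using rep by (auto simp: skorohod_representation_def)
  have C0: "0 \<le> C" using C[of 0] by (rule order_trans[rotated]) (simp add: second_moment_def)
  have "(\<integral>\<^sup>+ w. ennreal ((norm (Y w))\<^sup>2) \<partial>\<Omega>) = (\<integral>\<^sup>+ w. liminf (\<lambda>n. ennreal ((norm (X n w))\<^sup>2)) \<partial>\<Omega>)"
    using lim by (intro nn_integral_cong_AE)
      (auto elim!: eventually_mono intro!: lim_imp_Liminf[symmetric] tendsto_ennrealI tendsto_intros)
  also have "\<dots> \<le> liminf (\<lambda>n. \<integral>\<^sup>+ w. ennreal ((norm (X n w))\<^sup>2) \<partial>\<Omega>)"
    by (intro nn_integral_liminf) simp
  also have "\<dots> \<le> ennreal C"
  proof (intro Liminf_le always_eventually allI)
    fix n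
    have "(\<integral>\<^sup>+ w. ennreal ((norm (X n w))\<^sup>2) \<partial>\<Omega>) = (\<integral>\<^sup>+ x. ennreal ((norm x)\<^sup>2) \<partial>\<mu> n)"
      unfolding law(1)[of n, symmetric] by (subst nn_integral_distr) simp_all
    then show "(\<integral>\<^sup>+ w. ennreal ((norm (X n w))\<^sup>2) \<partial>\<Omega>) \<le> ennreal C"
      using P2D(4)[OF P[of n]] C[of n] by (simp add: ennreal_leI)
  qed simp
  finally have le: "(\<integral>\<^sup>+ w. ennreal ((norm (Y w))\<^sup>2) \<partial>\<Omega>) \<le> ennreal C" .
  then have i: "integrable \<Omega> (\<lambda>w. (norm (Y w))\<^sup>2)"
    by (intro integrableI_nonneg) (auto intro: le_less_trans)
  then show "\<rho> \<in> P2" using distr_in_P2_iff[OF \<Omega>, of Y] law(2) by simp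
  show "second_moment \<rho> \<le> C"
    using le nn_integral_eq_integral[OF i] C0 second_moment_distr[of Y \<Omega>] law(2) by simp
qed

text \<open>The quantitative Opial property of weak convergence. With \<open>X\<^sub>n \<rightarrow> X\<close>, \<open>Z\<^sub>n \<rightarrow> Z\<close> almost surely,
  expanding the squares gives
  \<open>|X\<^sub>n - Z\<^sub>n|\<^sup>2 - |X\<^sub>n - X|\<^sup>2 = |Z\<^sub>n|\<^sup>2 - |X|\<^sup>2 + 2 X\<^sub>n \<bullet> (X - Z\<^sub>n)\<close>, and Fatou's lemma applies after
  adding \<open>\<delta> |X\<^sub>n|\<^sup>2\<close> and terms with constant expectation.\<close>

theorem Opial_Wasserstein:
  fixes \<mu> :: "nat \<Rightarrow> 'a::euclidean_space measure"
  assumes rep: "skorohod_representation \<mu> \<rho> \<Omega>0 X0 Y0" and P: "\<And>n. \<mu> n \<in> P2" and C: "\<And>n. second_moment (\<mu> n) \<le> C"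
    and \<nu>: "\<nu> \<in> P2" and e: "0 < e"
  shows "\<exists>n\<ge>N. (Wasserstein 2 (\<mu> n) \<rho>)\<^sup>2 + (Wasserstein 2 \<rho> \<nu>)\<^sup>2 \<le> (Wasserstein 2 (\<mu> n) \<nu>)\<^sup>2 + e"
proof -
  note \<rho> = skorohod_representation_P2[OF rep P C]
  have C0: "0 \<le> C" using C[of 0] by (rule order_trans[rotated]) (simp add: second_moment_def)
  \<comment> \<open>The error \<open>e\<close> is spent in thirds: on near-optimality of the
    couplings, on the perturbation \<open>\<delta>\<close>, and on Fatou's lemma.\<close>
  have "\<forall>n. \<exists>\<gamma>\<in>couplings (\<mu> n) \<nu>. (\<integral>z. (norm (fst z - snd z))\<^sup>2 \<partial>\<gamma>) < (Wasserstein 2 (\<mu> n) \<nu>)\<^sup>2 + e / 3"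
    using near_optimal_coupling[OF P \<nu>] e by simp
  then obtain \<gamma> where \<gamma>: "\<And>n. \<gamma> n \<in> couplings (\<mu> n) \<nu>"
    "\<And>n. (\<integral>z. (norm (fst z - snd z))\<^sup>2 \<partial>\<gamma> n) < (Wasserstein 2 (\<mu> n) \<nu>)\<^sup>2 + e / 3"
    by metis
  note c = couplingsD[OF \<gamma>(1)] and i = couplings_square_integrable[OF \<gamma>(1) P \<nu>]
  have bnd: "(\<integral>\<^sup>+ z. ennreal ((norm z)\<^sup>2) \<partial>\<gamma> n) \<le> ennreal (C + second_moment \<nu>)" for n
  proof -
    have "(\<integral>\<^sup>+ z. ennreal ((norm z)\<^sup>2) \<partial>\<gamma> n) = (\<integral>\<^sup>+ z. ennreal ((norm (fst z))\<^sup>2 + (norm (snd z))\<^sup>2) \<partial>\<gamma> n)"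
      by (intro nn_integral_cong) (simp add: norm_prod_def)
    also have "\<dots> = ennreal (\<integral>z. (norm (fst z))\<^sup>2 + (norm (snd z))\<^sup>2 \<partial>\<gamma> n)"
      using i(1,2)[of n] by (intro nn_integral_eq_integral) simp_all
    also have "(\<integral>z. (norm (fst z))\<^sup>2 + (norm (snd z))\<^sup>2 \<partial>\<gamma> n) = second_moment (\<mu> n) + second_moment \<nu>"
      using i(1,2)[of n] second_moment_distr[OF c(3)[of n]] second_moment_distr[OF c(4)[of n]] c(5,6)[of n] by simp
    finally show ?thesis using C[of n] by (simp add: ennreal_leI)
  qed
  \<comment> \<open>Compactness is applied to the couplings, not to \<open>\<mu>\<close>, so that
    both marginals converge on one space; the given representation \<open>rep\<close> then
    identifies the law of the first limit as \<open>\<rho>\<close>.\<close>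
  obtain r \<rho>' \<Omega> U V where r: "strict_mono r" and rep': "skorohod_representation (\<gamma> \<circ> r) \<rho>' \<Omega> U V"
    using skorohod_representation_exists[of \<gamma>, OF c(1,2) bnd] by auto
  have \<Omega>: "prob_space \<Omega>" and U[measurable]: "U n \<in> borel_measurable \<Omega>" and V[measurable]: "V \<in> borel_measurable \<Omega>"
    and U_law: "distr \<Omega> borel (U n) = \<gamma> (r n)" and lim: "AE w in \<Omega>. (\<lambda>n. U n w) \<longlonglongrightarrow> V w" for n
    using rep' by (auto simp: skorohod_representation_def)
  interpret prob_space \<Omega> by fact
  define X where "X n w = fst (U n w)" for n w
  define Z where "Z n w = snd (U n w)" for n w
  define X' where "X' w = fst (V w)" for w
  define Z' where "Z' w = snd (V w)" for w
  have [measurable]: "X n \<in> borel_measurable \<Omega>" "Z n \<in> borel_measurable \<Omega>" for n unfolding X_def Z_def by measurable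
  have [measurable]: "X' \<in> borel_measurable \<Omega>" "Z' \<in> borel_measurable \<Omega>" unfolding X'_def Z'_def by measurable
  have limX: "AE w in \<Omega>. (\<lambda>n. X n w) \<longlonglongrightarrow> X' w" and limZ: "AE w in \<Omega>. (\<lambda>n. Z n w) \<longlonglongrightarrow> Z' w"
    using lim by (auto simp: X_def X'_def Z_def Z'_def elim!: eventually_mono intro: tendsto_fst tendsto_snd)
  have lawX: "distr \<Omega> borel (X n) = \<mu> (r n)" for n
    using c(5)[of "r n"] unfolding U_law[symmetric] by (simp add: distr_distr comp_def X_def[abs_def])
  have lawZ: "distr \<Omega> borel (Z n) = \<nu>" for n
    using c(6)[of "r n"] unfolding U_law[symmetric] by (simp add: distr_distr comp_def Z_def[abs_def])
  have "skorohod_representation (\<mu> \<circ> r) (distr \<Omega> borel X') \<Omega> X X'"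
    using \<Omega> limX lawX by (simp add: skorohod_representation_def)
  then have lawX': "distr \<Omega> borel X' = \<rho>"
    using skorohod_representation_unique skorohod_representation_subseq[OF rep r] by blast
  \<comment> \<open>All \<open>Z n\<close> have law \<open>\<nu>\<close>, so the limit is compared
    with that of the constant sequence \<open>Z 0\<close>.\<close>
  have lawZ': "distr \<Omega> borel Z' = \<nu>"
    using limit_law_unique[OF \<Omega> \<Omega>, of Z Z' "\<lambda>_. Z 0" "Z 0"] limZ lawZ by simp
  have iX: "integrable \<Omega> (\<lambda>w. (norm (X n w))\<^sup>2)" for n using distr_in_P2_iff[OF \<Omega>, of "X n"] P lawX by simp
  have iZ: "integrable \<Omega> (\<lambda>w. (norm (Z n w))\<^sup>2)" for n using distr_in_P2_iff[OF \<Omega>, of "Z n"] \<nu> lawZ by simp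
  have iX': "integrable \<Omega> (\<lambda>w. (norm (X' w))\<^sup>2)" using distr_in_P2_iff[OF \<Omega>, of X'] \<rho> lawX' by simp
  have iZ': "integrable \<Omega> (\<lambda>w. (norm (Z' w))\<^sup>2)" using distr_in_P2_iff[OF \<Omega>, of Z'] \<nu> lawZ' by simp
  have EZ: "(\<integral>w. (norm (Z n w))\<^sup>2 \<partial>\<Omega>) = (\<integral>w. (norm (Z' w))\<^sup>2 \<partial>\<Omega>)" for n
    using second_moment_distr[of "Z n" \<Omega>] second_moment_distr[of Z' \<Omega>] lawZ lawZ' by simp
  have EX: "(\<integral>w. (norm (X n w))\<^sup>2 \<partial>\<Omega>) \<le> C" for n
    using second_moment_distr[of "X n" \<Omega>] lawX[of n] C[of "r n"] by simp
  have EX': "0 \<le> (\<integral>w. (norm (X' w))\<^sup>2 \<partial>\<Omega>)" by simp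
  note sid = square_integrable_diff
  have iXZ: "integrable \<Omega> (\<lambda>w. (norm (X n w - Z n w))\<^sup>2)" for n by (intro sid iX iZ) simp_all
  have iXX: "integrable \<Omega> (\<lambda>w. (norm (X n w - X' w))\<^sup>2)" for n by (intro sid iX iX') simp_all
  have iXZ': "integrable \<Omega> (\<lambda>w. (norm (X' w - Z' w))\<^sup>2)" by (intro sid iX' iZ') simp_all
  \<comment> \<open>Chosen so that \<open>\<delta> * C\<close> is at most \<open>e / 3\<close>; the
    added 1 keeps the denominator positive when \<open>C = 0\<close>.\<close>
  define \<delta> where "\<delta> = e / (3 * (C + 1))"
  have \<delta>: "\<delta> > 0" "\<delta> * C \<le> e / 3" using e C0 by (auto simp: \<delta>_def field_simps)
  \<comment> \<open>By Young's inequality the term 2 X \<bullet> (X' - Z) is at least - \<delta>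
    |X|^2 - |X' - Z|^2 / \<delta>, and |X' - Z|^2 is at most 2 (|X'|^2 + |Z|^2). The added terms
    therefore make \<open>f n\<close> nonnegative. All of them except
    \<open>\<delta> * (norm (X n w))\<^sup>2\<close> have an expectation independent of n and cancel
    against those in \<open>g\<close>.\<close>
  define f where "f n w = (norm (X n w - Z n w))\<^sup>2 - (norm (X n w - X' w))\<^sup>2 + \<delta> * (norm (X n w))\<^sup>2
      + 2 / \<delta> * ((norm (X' w))\<^sup>2 + (norm (Z n w))\<^sup>2) + (norm (X' w))\<^sup>2" for n w
  define g where "g w = (norm (X' w - Z' w))\<^sup>2 + \<delta> * (norm (X' w))\<^sup>2
      + 2 / \<delta> * ((norm (X' w))\<^sup>2 + (norm (Z' w))\<^sup>2) + (norm (X' w))\<^sup>2" for w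
  have f0: "0 \<le> f n w" for n w
  proof -
    let ?x = "X n w" and ?y = "X' w - Z n w"
    have "0 \<le> (norm (\<delta> *\<^sub>R ?x + ?y))\<^sup>2" by simp
    also have "(norm (\<delta> *\<^sub>R ?x + ?y))\<^sup>2 = \<delta>\<^sup>2 * (norm ?x)\<^sup>2 + 2 * \<delta> * (?x \<bullet> ?y) + (norm ?y)\<^sup>2"
      by (simp only: power2_norm_eq_inner inner_add_left inner_add_right inner_scaleR_left inner_scaleR_right inner_commute[of ?y ?x])
         (simp add: power2_eq_square algebra_simps)
    also have "\<dots> = \<delta> * (\<delta> * (norm ?x)\<^sup>2 + 2 * (?x \<bullet> ?y) + (norm ?y)\<^sup>2 / \<delta>)"
      using \<delta>(1) by (simp add: distrib_left power2_eq_square)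
    finally have 1: "0 \<le> \<delta> * (norm ?x)\<^sup>2 + 2 * (?x \<bullet> ?y) + (norm ?y)\<^sup>2 / \<delta>"
      using \<delta>(1) by (simp add: zero_le_mult_iff)
    have "(norm ?y)\<^sup>2 \<le> 2 * ((norm (X' w))\<^sup>2 + (norm (Z n w))\<^sup>2)"
      using zero_le_power2[of "norm (X' w + Z n w)"]
      by (simp add: power2_norm_eq_inner inner_diff_left inner_diff_right inner_add_left inner_add_right inner_commute)
    then have "(norm ?y)\<^sup>2 / \<delta> \<le> 2 / \<delta> * ((norm (X' w))\<^sup>2 + (norm (Z n w))\<^sup>2)"
      using divide_right_mono[of _ _ \<delta>] \<delta>(1) by fastforce
    then show ?thesis
      using 1 unfolding f_def norm_diff_sq by (simp add: inner_diff_right)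
  qed
  have lim_f: "AE w in \<Omega>. (\<lambda>n. f n w) \<longlonglongrightarrow> g w"
    using limX limZ
  proof eventually_elim
    fix w assume "(\<lambda>n. X n w) \<longlonglongrightarrow> X' w" "(\<lambda>n. Z n w) \<longlonglongrightarrow> Z' w"
    then have "(\<lambda>n. f n w) \<longlonglongrightarrow> (norm (X' w - Z' w))\<^sup>2 - (norm (X' w - X' w))\<^sup>2 + \<delta> * (norm (X' w))\<^sup>2
      + 2 / \<delta> * ((norm (X' w))\<^sup>2 + (norm (Z' w))\<^sup>2) + (norm (X' w))\<^sup>2"
      unfolding f_def by (intro tendsto_intros)
    then show "(\<lambda>n. f n w) \<longlonglongrightarrow> g w" by (simp add: g_def)
  qed
  have f_int: "integrable \<Omega> (f n)" for n
    unfolding f_def by (intro Bochner_Integration.integrable_add Bochner_Integration.integrable_diff integrable_mult_right iX iZ iX' iXZ iXX)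
  have g_int: "integrable \<Omega> g"
    unfolding g_def by (intro Bochner_Integration.integrable_add integrable_mult_right iX' iZ' iXZ')
  have Ef: "integral\<^sup>L \<Omega> (f n) = (\<integral>w. (norm (X n w - Z n w))\<^sup>2 \<partial>\<Omega>) - (\<integral>w. (norm (X n w - X' w))\<^sup>2 \<partial>\<Omega>)
     + \<delta> * (\<integral>w. (norm (X n w))\<^sup>2 \<partial>\<Omega>) + 2 / \<delta> * ((\<integral>w. (norm (X' w))\<^sup>2 \<partial>\<Omega>) + (\<integral>w. (norm (Z' w))\<^sup>2 \<partial>\<Omega>)) + (\<integral>w. (norm (X' w))\<^sup>2 \<partial>\<Omega>)" for n
    unfolding f_def EZ[of n, symmetric] using iX[of n] iZ[of n] iX' iXZ[of n] iXX[of n] by simp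
  have Eg: "integral\<^sup>L \<Omega> g = (\<integral>w. (norm (X' w - Z' w))\<^sup>2 \<partial>\<Omega>)
     + \<delta> * (\<integral>w. (norm (X' w))\<^sup>2 \<partial>\<Omega>) + 2 / \<delta> * ((\<integral>w. (norm (X' w))\<^sup>2 \<partial>\<Omega>) + (\<integral>w. (norm (Z' w))\<^sup>2 \<partial>\<Omega>)) + (\<integral>w. (norm (X' w))\<^sup>2 \<partial>\<Omega>)"
    unfolding g_def using iX' iZ' iXZ' by simp
  have "\<forall>\<^sub>F n in sequentially. integral\<^sup>L \<Omega> g - e / 3 < integral\<^sup>L \<Omega> (f n)"
    using e by (intro integral_Fatou_eventually f_int g_int lim_f) (simp_all add: f0)
  then obtain n where n: "n \<ge> N" "integral\<^sup>L \<Omega> g - e / 3 < integral\<^sup>L \<Omega> (f n)"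
    by (metis eventually_sequentially nat_le_linear)
  \<comment> \<open>Only the coupling of \<open>\<mu> (r n)\<close> and \<open>\<nu>\<close> has to
    be nearly optimal; the other two distances are wanted from above, where any coupling
    does.\<close>
  have "(Wasserstein 2 \<rho> \<nu>)\<^sup>2 \<le> (\<integral>w. (norm (X' w - Z' w))\<^sup>2 \<partial>\<Omega>)"
    by (rule Wasserstein_2_le[OF \<Omega> _ _ lawX' lawZ' \<rho>(1) \<nu>]) simp_all
  moreover have "(Wasserstein 2 (\<mu> (r n)) \<rho>)\<^sup>2 \<le> (\<integral>w. (norm (X n w - X' w))\<^sup>2 \<partial>\<Omega>)"
    by (rule Wasserstein_2_le[OF \<Omega> _ _ lawX lawX' P \<rho>(1)]) simp_all
  moreover have "(\<integral>w. (norm (X n w - Z n w))\<^sup>2 \<partial>\<Omega>) < (Wasserstein 2 (\<mu> (r n)) \<nu>)\<^sup>2 + e / 3"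
    using \<gamma>(2)[of "r n"] unfolding U_law[symmetric] by (subst (asm) integral_distr) (simp_all add: X_def Z_def)
  moreover have "\<delta> * (\<integral>w. (norm (X n w))\<^sup>2 \<partial>\<Omega>) \<le> e / 3"
    using mult_left_mono[OF EX, of \<delta> n] \<delta> by linarith
  moreover have "0 \<le> \<delta> * (\<integral>w. (norm (X' w))\<^sup>2 \<partial>\<Omega>)" using \<delta> EX' by simp
  ultimately have "(Wasserstein 2 (\<mu> (r n)) \<rho>)\<^sup>2 + (Wasserstein 2 \<rho> \<nu>)\<^sup>2 \<le> (Wasserstein 2 (\<mu> (r n)) \<nu>)\<^sup>2 + e"
    using n(2) unfolding Ef Eg by linarith
  moreover have "N \<le> r n" using n(1) seq_suble[OF r, of n] by linarith
  ultimately show ?thesis by blast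
qed

section \<open>Weak convergence and generalized geodesics\<close>

text \<open>Splitting at \<open>a = R\<close>. Since p < 2 the factor \<open>R powr (p - 2)\<close>
  is small for large R, which is the uniform integrability of p-th powers under a second moment
  bound.\<close>

lemma powr_le_add_square:
  fixes a R p :: real
  assumes "0 \<le> a" "0 < R" "1 \<le> p" "p < 2"
  shows "a powr p \<le> R powr p + R powr (p - 2) * a\<^sup>2"
proof (cases "a \<le> R")
  case True
  then have "a powr p \<le> R powr p" using assms by (intro powr_mono2) auto
  then show ?thesis by (simp add: add_increasing2)
next
  case False
  then have a: "0 < a" using assms by simp
  have "a powr p = a powr (p - 2) * a powr 2" by (simp flip: powr_add)
  also have "\<dots> = a powr (p - 2) * a\<^sup>2" using a by simp
  also have "\<dots> \<le> R powr (p - 2) * a\<^sup>2"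
    using assms False by (intro mult_right_mono powr_mono2') auto
  finally show ?thesis by (simp add: add_increasing)
qed

lemma Wasserstein_le:
  assumes \<Omega>: "prob_space \<Omega>" and [measurable]: "X \<in> borel_measurable \<Omega>" "Y \<in> borel_measurable \<Omega>"
    and law: "distr \<Omega> borel X = \<mu>" "distr \<Omega> borel Y = \<nu>" and p: "0 < p"
    and i: "integrable \<Omega> (\<lambda>w. norm (X w - Y w) powr p)"
  shows "Wasserstein p \<mu> \<nu> \<le> (\<integral>w. norm (X w - Y w) powr p \<partial>\<Omega>) powr (1 / p)"
proof -
  have "(INF \<gamma>\<in>couplings \<mu> \<nu>. transport_cost p \<gamma>) \<le> transport_cost p (distr \<Omega> borel (\<lambda>w. (X w, Y w)))"
    using couplings_distr[OF assms(1-3)] law by (intro INF_lower) simp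
  also have "\<dots> = ennreal (\<integral>w. norm (X w - Y w) powr p \<partial>\<Omega>)"
    unfolding transport_cost_distr[OF assms(2,3)] by (rule nn_integral_eq_integral[OF i]) simp
  finally have "enn2real (INF \<gamma>\<in>couplings \<mu> \<nu>. transport_cost p \<gamma>) \<le> (\<integral>w. norm (X w - Y w) powr p \<partial>\<Omega>)"
    by (intro enn2real_leI) simp_all
  then show ?thesis unfolding Wasserstein_def using p by (intro powr_mono2) auto
qed

text \<open>With \<open>D n\<close> the distance of the represented points, Fatou's lemma is applied
  to the nonnegative function
  \<open>R powr p + R powr (p - 2) * (D n w)\<^sup>2 - D n w powr p\<close>, which tends to
  \<open>R powr p\<close>. This leaves a p-th moment of at most \<open>R powr (p - 2)\<close> times
  the second moment of \<open>D n\<close>, up to an arbitrarily small error.\<close>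

lemma Wasserstein_tendsto_zero:
  fixes \<mu> :: "nat \<Rightarrow> 'a::euclidean_space measure"
  assumes rep: "skorohod_representation \<mu> \<rho> \<Omega> X Y" and P: "\<And>n. \<mu> n \<in> P2" and C: "\<And>n. second_moment (\<mu> n) \<le> C"
    and p: "1 \<le> p" "p < 2"
  shows "(\<lambda>n. Wasserstein p (\<mu> n) \<rho>) \<longlonglongrightarrow> 0"
proof -
  note \<rho> = skorohod_representation_P2[OF rep P C]
  have C0: "0 \<le> C" using C[of 0] by (rule order_trans[rotated]) (simp add: second_moment_def)
  have \<Omega>: "prob_space \<Omega>" and [measurable]: "X n \<in> borel_measurable \<Omega>" "Y \<in> borel_measurable \<Omega>"
    and law: "distr \<Omega> borel (X n) = \<mu> n" "distr \<Omega> borel Y = \<rho>"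
    and lim: "AE w in \<Omega>. (\<lambda>n. X n w) \<longlonglongrightarrow> Y w" for n
    using rep by (auto simp: skorohod_representation_def)
  interpret prob_space \<Omega> by fact
  define D where "D n w = norm (X n w - Y w)" for n w
  have [measurable]: "D n \<in> borel_measurable \<Omega>" for n unfolding D_def by measurable
  have iX: "integrable \<Omega> (\<lambda>w. (norm (X n w))\<^sup>2)" for n using distr_in_P2_iff[OF \<Omega>, of "X n"] P law by simp
  have iY: "integrable \<Omega> (\<lambda>w. (norm (Y w))\<^sup>2)" using distr_in_P2_iff[OF \<Omega>, of Y] \<rho> law by simp
  have iD: "integrable \<Omega> (\<lambda>w. (D n w)\<^sup>2)" for n
    unfolding D_def by (intro square_integrable_diff iX iY) simp_all
  have D2: "(\<integral>w. (D n w)\<^sup>2 \<partial>\<Omega>) \<le> 4 * C" for n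
  proof -
    have "(\<integral>w. (D n w)\<^sup>2 \<partial>\<Omega>) \<le> (\<integral>w. 2 * (norm (X n w))\<^sup>2 + 2 * (norm (Y w))\<^sup>2 \<partial>\<Omega>)"
    proof (intro integral_mono iD Bochner_Integration.integrable_add integrable_mult_right iX iY)
      fix w
      show "(D n w)\<^sup>2 \<le> 2 * (norm (X n w))\<^sup>2 + 2 * (norm (Y w))\<^sup>2"
        using zero_le_power2[of "norm (X n w + Y w)"]
        by (simp add: D_def power2_norm_eq_inner inner_diff_left inner_diff_right inner_add_left inner_add_right inner_commute)
    qed
    also have "\<dots> = 2 * second_moment (\<mu> n) + 2 * second_moment \<rho>"
      using iX[of n] iY second_moment_distr[of "X n" \<Omega>] second_moment_distr[of Y \<Omega>] law by simp
    finally show ?thesis using C[of n] \<rho>(2) by simp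
  qed
  have ip: "integrable \<Omega> (\<lambda>w. D n w powr p)" for n
  proof (rule Bochner_Integration.integrable_bound[OF Bochner_Integration.integrable_add[OF integrable_const[of "1 :: real"] iD[of n]]])
    show "AE w in \<Omega>. norm (D n w powr p) \<le> norm (1 + (D n w)\<^sup>2)"
      using powr_le_add_square[of _ 1 p] p by (intro AE_I2) (simp add: D_def)
  qed simp
  have "(\<lambda>n. \<integral>w. D n w powr p \<partial>\<Omega>) \<longlonglongrightarrow> 0"
  proof (rule tendstoI)
    fix e :: real assume e: "0 < e"
    have "((\<lambda>R. R powr (p - 2)) \<longlongrightarrow> 0) at_top"
      using p by (intro tendsto_neg_powr filterlim_ident) auto
    \<comment> \<open>Here \<open>4 * C\<close> bounds the second moment of \<open>D n\<close>, and
      the added 1 keeps the denominator positive.\<close>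
    then have "\<forall>\<^sub>F R in at_top. R powr (p - 2) < e / (2 * (4 * C + 1))"
      using e C0 by (intro order_tendstoD) auto
    then obtain R where R: "0 < R" "R powr (p - 2) < e / (2 * (4 * C + 1))"
      using eventually_happens[OF eventually_conj[OF eventually_gt_at_top[of 0]]] by auto
    have small: "R powr (p - 2) * (\<integral>w. (D n w)\<^sup>2 \<partial>\<Omega>) \<le> e / 2" for n
    proof -
      have "R powr (p - 2) * (\<integral>w. (D n w)\<^sup>2 \<partial>\<Omega>) \<le> e / (2 * (4 * C + 1)) * (4 * C + 1)"
        using R D2[of n] C0 e by (intro mult_mono) auto
      moreover have "e / (2 * K) * K = e / 2" if "K \<noteq> 0" for K :: real using that by simp
      moreover have "4 * C + 1 \<noteq> 0" using C0 by linarith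
      ultimately show ?thesis by metis
    qed
    have lim0: "AE w in \<Omega>. (\<lambda>n. R powr p + R powr (p - 2) * (D n w)\<^sup>2 - D n w powr p) \<longlonglongrightarrow> R powr p"
      using lim
    proof eventually_elim
      fix w assume "(\<lambda>n. X n w) \<longlonglongrightarrow> Y w"
      then have D0: "(\<lambda>n. D n w) \<longlonglongrightarrow> 0" unfolding D_def by (simp add: tendsto_norm_zero LIM_zero)
      then have "(\<lambda>n. D n w powr p) \<longlonglongrightarrow> 0 powr p"
        using p by (intro tendsto_powr2 tendsto_const) (auto simp: D_def)
      then have "(\<lambda>n. R powr p + R powr (p - 2) * (D n w)\<^sup>2 - D n w powr p) \<longlonglongrightarrow> R powr p + R powr (p - 2) * 0\<^sup>2 - 0 powr p"
        using D0 by (intro tendsto_add tendsto_diff tendsto_const tendsto_mult tendsto_power)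
      then show "(\<lambda>n. R powr p + R powr (p - 2) * (D n w)\<^sup>2 - D n w powr p) \<longlonglongrightarrow> R powr p" using p by simp
    qed
    have "\<forall>\<^sub>F n in sequentially. (\<integral>w. R powr p \<partial>\<Omega>) - e / 2 < (\<integral>w. R powr p + R powr (p - 2) * (D n w)\<^sup>2 - D n w powr p \<partial>\<Omega>)"
    proof (rule integral_Fatou_eventually[OF _ _ _ lim0])
      show "AE w in \<Omega>. 0 \<le> R powr p + R powr (p - 2) * (D n w)\<^sup>2 - D n w powr p" for n
        using powr_le_add_square[OF _ R(1) p] by (intro AE_I2) (simp add: D_def)
    qed (use e iD ip in simp_all)
    then show "\<forall>\<^sub>F n in sequentially. dist (\<integral>w. D n w powr p \<partial>\<Omega>) 0 < e"
    proof eventually_elim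
      fix n assume "(\<integral>w. R powr p \<partial>\<Omega>) - e / 2 < (\<integral>w. R powr p + R powr (p - 2) * (D n w)\<^sup>2 - D n w powr p \<partial>\<Omega>)"
      moreover have "(\<integral>w. R powr p + R powr (p - 2) * (D n w)\<^sup>2 - D n w powr p \<partial>\<Omega>)
          = R powr p + R powr (p - 2) * (\<integral>w. (D n w)\<^sup>2 \<partial>\<Omega>) - (\<integral>w. D n w powr p \<partial>\<Omega>)"
        using iD[of n] ip[of n] by (simp add: prob_space)
      moreover have "0 \<le> (\<integral>w. D n w powr p \<partial>\<Omega>)" by simp
      ultimately show "dist (\<integral>w. D n w powr p \<partial>\<Omega>) 0 < e"
        using small[of n] by (simp add: prob_space dist_real_def)
    qed
  qed
  then have "(\<lambda>n. (\<integral>w. D n w powr p \<partial>\<Omega>) powr (1 / p)) \<longlonglongrightarrow> 0 powr (1 / p)"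
    using p by (intro tendsto_powr2 tendsto_const) auto
  then have to_0: "(\<lambda>n. (\<integral>w. D n w powr p \<partial>\<Omega>) powr (1 / p)) \<longlonglongrightarrow> 0" by simp
  have "\<forall>\<^sub>F n in sequentially. Wasserstein p (\<mu> n) \<rho> \<le> (\<integral>w. D n w powr p \<partial>\<Omega>) powr (1 / p)"
    unfolding D_def using law p ip[unfolded D_def] \<Omega> by (intro always_eventually allI Wasserstein_le) simp_all
  then show ?thesis by (rule tendsto_sandwich[OF _ _ tendsto_const to_0, rotated]) simp
qed

lemma LIMSEQ_subsubseq:
  fixes a :: "nat \<Rightarrow> 'b::topological_space"
  assumes "\<And>r. strict_mono (r :: nat \<Rightarrow> nat) \<Longrightarrow> \<exists>s. strict_mono (s :: nat \<Rightarrow> nat) \<and> (a \<circ> r \<circ> s) \<longlonglongrightarrow> l"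
  shows "a \<longlonglongrightarrow> l"
proof (rule topological_tendstoI, rule ccontr)
  fix S assume S: "open S" "l \<in> S" and "\<not> (\<forall>\<^sub>F n in sequentially. a n \<in> S)"
  then have "infinite {n. a n \<notin> S}"
    by (simp add: frequently_cofinite[symmetric] cofinite_eq_sequentially not_eventually)
  then obtain r :: "nat \<Rightarrow> nat" where r: "strict_mono r" "\<And>n. a (r n) \<notin> S"
    using infinite_enumerate by blast
  then obtain s where s: "(a \<circ> r \<circ> s) \<longlonglongrightarrow> l" using assms by blast
  then have "\<forall>\<^sub>F n in sequentially. (a \<circ> r \<circ> s) n \<in> S" using S by (rule topological_tendstoD)
  then show False using r(2) by (auto simp: eventually_sequentially)
qed

text \<open>The weights are tuned to give equality at y = a, z = b. After integration this replaces
  Minkowski's inequality in the triangle inequality.\<close>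

lemma weighted_young:
  fixes a b y z :: real
  assumes "0 < a" "0 < b"
  shows "(y + z)\<^sup>2 \<le> (1 + b / a) * y\<^sup>2 + (1 + a / b) * z\<^sup>2"
proof -
  have "sqrt (b / a) * sqrt (a / b) = 1" using assms by (simp flip: real_sqrt_mult)
  then have "2 * y * z = 2 * (sqrt (b / a) * y) * (sqrt (a / b) * z)" by algebra
  also have "\<dots> \<le> (sqrt (b / a) * y)\<^sup>2 + (sqrt (a / b) * z)\<^sup>2" by (rule sum_squares_bound)
  also have "\<dots> = b / a * y\<^sup>2 + a / b * z\<^sup>2" using assms by (simp add: power_mult_distrib)
  finally show ?thesis by (simp add: power2_sum distrib_right)
qed

text \<open>Rewrites a generalized geodesic in random variables on one space. The pairs with the
  base are exactly optimal; the pair (Y, Z) is merely some coupling.\<close>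

lemma gen_geodesic_plan:
  fixes G :: "'a::euclidean_space measure \<Rightarrow> ereal"
  assumes conv: "convex_along_gen_geodesics G" and P: "\<nu> \<in> P2" "\<mu>0 \<in> P2" "\<mu>1 \<in> P2"
  shows "\<exists>(\<gamma> :: ('a \<times> 'a \<times> 'a) measure) X Y Z. prob_space \<gamma> \<and>
      X \<in> borel_measurable \<gamma> \<and> Y \<in> borel_measurable \<gamma> \<and> Z \<in> borel_measurable \<gamma> \<and>
      distr \<gamma> borel X = \<nu> \<and> distr \<gamma> borel Y = \<mu>0 \<and> distr \<gamma> borel Z = \<mu>1 \<and>
      (\<integral>w. (norm (X w - Y w))\<^sup>2 \<partial>\<gamma>) = (Wasserstein 2 \<nu> \<mu>0)\<^sup>2 \<and>
      (\<integral>w. (norm (X w - Z w))\<^sup>2 \<partial>\<gamma>) = (Wasserstein 2 \<nu> \<mu>1)\<^sup>2 \<and>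
      (\<forall>t\<in>{0..1}. G (distr \<gamma> borel (\<lambda>w. (1 - t) *\<^sub>R Y w + t *\<^sub>R Z w)) \<le> ereal (1 - t) * G \<mu>0 + ereal t * G \<mu>1)"
proof -
  obtain m where m: "generalized_geodesic \<nu> \<mu>0 \<mu>1 m" "\<forall>s\<in>{0..1}. G (m s) \<le> ereal (1 - s) * G \<mu>0 + ereal s * G \<mu>1"
    using conv P unfolding convex_along_gen_geodesics_def by blast
  obtain \<gamma> :: "('a \<times> 'a \<times> 'a) measure" where \<gamma>: "prob_space \<gamma>" and s: "sets \<gamma> = sets borel"
    and law: "distr \<gamma> borel (\<lambda>(x, y, z). x) = \<nu>" "distr \<gamma> borel (\<lambda>(x, y, z). y) = \<mu>0" "distr \<gamma> borel (\<lambda>(x, y, z). z) = \<mu>1"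
    and opt: "distr \<gamma> borel (\<lambda>(x, y, z). (x, y)) \<in> opt_couplings \<nu> \<mu>0" "distr \<gamma> borel (\<lambda>(x, y, z). (x, z)) \<in> opt_couplings \<nu> \<mu>1"
    and mt: "\<forall>t\<in>{0..1}. m t = distr \<gamma> borel (\<lambda>(x, y, z). (1 - t) *\<^sub>R y + t *\<^sub>R z)"
    using m(1) unfolding generalized_geodesic_def by blast
  define X :: "'a \<times> 'a \<times> 'a \<Rightarrow> 'a" where "X w = fst w" for w
  define Y :: "'a \<times> 'a \<times> 'a \<Rightarrow> 'a" where "Y w = fst (snd w)" for w
  define Z :: "'a \<times> 'a \<times> 'a \<Rightarrow> 'a" where "Z w = snd (snd w)" for w
  have cp: "(\<lambda>(x, y, z). f x y z) = (\<lambda>w. f (X w) (Y w) (Z w))" for f :: "'a \<Rightarrow> 'a \<Rightarrow> 'a \<Rightarrow> 'c"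
    by (auto simp: X_def Y_def Z_def)
  have [measurable]: "X \<in> borel_measurable \<gamma>" "Y \<in> borel_measurable \<gamma>" "Z \<in> borel_measurable \<gamma>"
    unfolding measurable_cong_sets[OF s refl] X_def Y_def Z_def by measurable
  have "(\<integral>w. (norm (X w - Y w))\<^sup>2 \<partial>\<gamma>) = (Wasserstein 2 \<nu> \<mu>0)\<^sup>2"
    using opt_couplings_cost(2)[OF opt(1) P(1,2)] unfolding cp by (subst (asm) integral_distr) simp_all
  moreover have "(\<integral>w. (norm (X w - Z w))\<^sup>2 \<partial>\<gamma>) = (Wasserstein 2 \<nu> \<mu>1)\<^sup>2"
    using opt_couplings_cost(2)[OF opt(2) P(1,3)] unfolding cp by (subst (asm) integral_distr) simp_all
  moreover have "\<forall>t\<in>{0..1}. G (distr \<gamma> borel (\<lambda>w. (1 - t) *\<^sub>R Y w + t *\<^sub>R Z w)) \<le> ereal (1 - t) * G \<mu>0 + ereal t * G \<mu>1"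
    using m(2) mt unfolding cp by simp
  moreover have "distr \<gamma> borel X = \<nu>" "distr \<gamma> borel Y = \<mu>0" "distr \<gamma> borel Z = \<mu>1"
    using law unfolding cp by simp_all
  ultimately show ?thesis using \<gamma>
    by (intro exI[of _ \<gamma>] exI[of _ X] exI[of _ Y] exI[of _ Z]) simp
qed

text \<open>Generalized geodesics glue optimal plans along their base, so the convexity assumption already
  contains the gluing lemma behind the triangle inequality.\<close>

lemma Wasserstein_2_triangle:
  fixes G :: "'a::euclidean_space measure \<Rightarrow> ereal" and \<nu> \<mu>0 \<mu>1 :: "'a measure"
  assumes conv: "convex_along_gen_geodesics G" and P: "\<nu> \<in> P2" "\<mu>0 \<in> P2" "\<mu>1 \<in> P2"
  shows "Wasserstein 2 \<mu>0 \<mu>1 \<le> Wasserstein 2 \<mu>0 \<nu> + Wasserstein 2 \<nu> \<mu>1"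
proof -
  obtain \<gamma> :: "('a \<times> 'a \<times> 'a) measure" and X Y Z where \<gamma>: "prob_space \<gamma>"
    and [measurable]: "X \<in> borel_measurable \<gamma>" "Y \<in> borel_measurable \<gamma>" "Z \<in> borel_measurable \<gamma>"
    and law: "distr \<gamma> borel X = \<nu>" "distr \<gamma> borel Y = \<mu>0" "distr \<gamma> borel Z = \<mu>1"
    and XY: "(\<integral>w. (norm (X w - Y w))\<^sup>2 \<partial>\<gamma>) = (Wasserstein 2 \<nu> \<mu>0)\<^sup>2"
    and XZ: "(\<integral>w. (norm (X w - Z w))\<^sup>2 \<partial>\<gamma>) = (Wasserstein 2 \<nu> \<mu>1)\<^sup>2"
    using gen_geodesic_plan[OF assms] by (elim exE conjE) (rule that)
  have iX: "integrable \<gamma> (\<lambda>w. (norm (X w))\<^sup>2)" using distr_in_P2_iff[OF \<gamma>, of X] law P by simp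
  have iY: "integrable \<gamma> (\<lambda>w. (norm (Y w))\<^sup>2)" using distr_in_P2_iff[OF \<gamma>, of Y] law P by simp
  have iZ: "integrable \<gamma> (\<lambda>w. (norm (Z w))\<^sup>2)" using distr_in_P2_iff[OF \<gamma>, of Z] law P by simp
  have iXY: "integrable \<gamma> (\<lambda>w. (norm (X w - Y w))\<^sup>2)" by (intro square_integrable_diff iX iY) simp_all
  have iXZ: "integrable \<gamma> (\<lambda>w. (norm (X w - Z w))\<^sup>2)" by (intro square_integrable_diff iX iZ) simp_all
  have iYZ: "integrable \<gamma> (\<lambda>w. (norm (Y w - Z w))\<^sup>2)" by (intro square_integrable_diff iY iZ) simp_all
  let ?a = "Wasserstein 2 \<nu> \<mu>0" and ?b = "Wasserstein 2 \<nu> \<mu>1"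
  have "Wasserstein 2 \<mu>0 \<mu>1 \<le> ?a + ?b"
  proof (rule field_le_epsilon)
    fix e :: real assume e: "0 < e"
    \<comment> \<open>The shift by \<open>e / 2\<close> keeps the weights \<open>b / a\<close> and
      \<open>a / b\<close> meaningful when a distance is 0.\<close>
    define a where "a = ?a + e / 2"
    define b where "b = ?b + e / 2"
    have ab: "0 < a" "0 < b" "?a \<le> a" "?b \<le> b" using e by (auto simp: a_def b_def add_nonneg_pos)
    have young: "(norm (Y w - Z w))\<^sup>2 \<le> (1 + b / a) * (norm (X w - Y w))\<^sup>2 + (1 + a / b) * (norm (X w - Z w))\<^sup>2" for w
    proof -
      let ?y = "norm (X w - Y w)" and ?z = "norm (X w - Z w)"
      have "norm (Y w - Z w) \<le> ?y + ?z"
        using norm_triangle_ineq4[of "X w - Z w" "X w - Y w"] by simp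
      then have "(norm (Y w - Z w))\<^sup>2 \<le> (?y + ?z)\<^sup>2" by (intro power_mono) simp_all
      also have "\<dots> \<le> (1 + b / a) * ?y\<^sup>2 + (1 + a / b) * ?z\<^sup>2" by (rule weighted_young[OF ab(1,2)])
      finally show ?thesis .
    qed
    have "(Wasserstein 2 \<mu>0 \<mu>1)\<^sup>2 \<le> (\<integral>w. (norm (Y w - Z w))\<^sup>2 \<partial>\<gamma>)"
      by (rule Wasserstein_2_le[OF \<gamma> _ _ law(2,3) P(2,3)]) simp_all
    also have "\<dots> \<le> (\<integral>w. (1 + b / a) * (norm (X w - Y w))\<^sup>2 + (1 + a / b) * (norm (X w - Z w))\<^sup>2 \<partial>\<gamma>)"
      using young by (intro integral_mono iYZ Bochner_Integration.integrable_add integrable_mult_right iXY iXZ)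
    also have "\<dots> = (1 + b / a) * ?a\<^sup>2 + (1 + a / b) * ?b\<^sup>2"
      using iXY iXZ XY XZ by simp
    also have "\<dots> \<le> (1 + b / a) * a\<^sup>2 + (1 + a / b) * b\<^sup>2"
      using ab by (intro add_mono mult_left_mono power_mono) simp_all
    also have "\<dots> = (a + b)\<^sup>2" using ab by (simp add: power2_eq_square distrib_right distrib_left)
    finally have "Wasserstein 2 \<mu>0 \<mu>1 \<le> a + b" by (rule power2_le_imp_le) (use ab in simp)
    then show "Wasserstein 2 \<mu>0 \<mu>1 \<le> ?a + ?b + e" by (simp add: a_def b_def)
  qed
  then show ?thesis using Wasserstein_2_commute[OF P(1,2)] by simp
qed

text \<open>An infimum equal to 0 says little without a coupling attaining it. The convexity
  assumption provides an optimal plan, and cost 0 puts it on the diagonal.\<close>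

lemma Wasserstein_2_eq_0_imp_eq:
  fixes G :: "'a::euclidean_space measure \<Rightarrow> ereal" and \<mu> \<nu> :: "'a measure"
  assumes conv: "convex_along_gen_geodesics G" and P: "\<mu> \<in> P2" "\<nu> \<in> P2" and 0: "Wasserstein 2 \<mu> \<nu> = 0"
  shows "\<mu> = \<nu>"
proof -
  obtain \<gamma> :: "('a \<times> 'a \<times> 'a) measure" and X Y where \<gamma>: "prob_space \<gamma>"
    and [measurable]: "X \<in> borel_measurable \<gamma>" "Y \<in> borel_measurable \<gamma>"
    and law: "distr \<gamma> borel X = \<mu>" "distr \<gamma> borel Y = \<nu>"
    and XY: "(\<integral>w. (norm (X w - Y w))\<^sup>2 \<partial>\<gamma>) = (Wasserstein 2 \<mu> \<nu>)\<^sup>2"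
    using gen_geodesic_plan[OF conv P P(2)] by (elim exE conjE) (rule that)
  have iX: "integrable \<gamma> (\<lambda>w. (norm (X w))\<^sup>2)" using distr_in_P2_iff[OF \<gamma>, of X] law P by simp
  have iY: "integrable \<gamma> (\<lambda>w. (norm (Y w))\<^sup>2)" using distr_in_P2_iff[OF \<gamma>, of Y] law P by simp
  have iXY: "integrable \<gamma> (\<lambda>w. (norm (X w - Y w))\<^sup>2)" by (intro square_integrable_diff iX iY) simp_all
  have "AE w in \<gamma>. (norm (X w - Y w))\<^sup>2 = 0"
    using integral_nonneg_eq_0_iff_AE[OF iXY] XY 0 by simp
  then have "AE w in \<gamma>. X w = Y w" by (elim eventually_mono) simp
  then have "distr \<gamma> borel X = distr \<gamma> borel Y" by (intro distr_cong_AE) simp_all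
  then show ?thesis using law by simp
qed

text \<open>Integrates the Hilbert space identity for |x - ((1-t) y + t z)|^2. The first two terms
  are exact because their plans are optimal; the third has a negative sign, so the arbitrary
  coupling (Y, Z) errs in the right direction.\<close>

lemma gen_geodesic_point:
  fixes G :: "'a::euclidean_space measure \<Rightarrow> ereal" and \<nu> \<mu>0 \<mu>1 :: "'a measure"
  assumes conv: "convex_along_gen_geodesics G" and P: "\<nu> \<in> P2" "\<mu>0 \<in> P2" "\<mu>1 \<in> P2" and t: "t \<in> {0..1}"
  shows "\<exists>m\<in>P2. G m \<le> ereal (1 - t) * G \<mu>0 + ereal t * G \<mu>1 \<and>
    (Wasserstein 2 m \<nu>)\<^sup>2 \<le> (1 - t) * (Wasserstein 2 \<mu>0 \<nu>)\<^sup>2 + t * (Wasserstein 2 \<mu>1 \<nu>)\<^sup>2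
      - t * (1 - t) * (Wasserstein 2 \<mu>0 \<mu>1)\<^sup>2"
proof -
  obtain \<gamma> :: "('a \<times> 'a \<times> 'a) measure" and X Y Z where \<gamma>: "prob_space \<gamma>"
    and [measurable]: "X \<in> borel_measurable \<gamma>" "Y \<in> borel_measurable \<gamma>" "Z \<in> borel_measurable \<gamma>"
    and law: "distr \<gamma> borel X = \<nu>" "distr \<gamma> borel Y = \<mu>0" "distr \<gamma> borel Z = \<mu>1"
    and XY: "(\<integral>w. (norm (X w - Y w))\<^sup>2 \<partial>\<gamma>) = (Wasserstein 2 \<nu> \<mu>0)\<^sup>2"
    and XZ: "(\<integral>w. (norm (X w - Z w))\<^sup>2 \<partial>\<gamma>) = (Wasserstein 2 \<nu> \<mu>1)\<^sup>2"
    and Gt: "\<forall>t\<in>{0..1}. G (distr \<gamma> borel (\<lambda>w. (1 - t) *\<^sub>R Y w + t *\<^sub>R Z w)) \<le> ereal (1 - t) * G \<mu>0 + ereal t * G \<mu>1"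
    using gen_geodesic_plan[OF assms(1-4)] by (elim exE conjE) (rule that)
  define V where "V w = (1 - t) *\<^sub>R Y w + t *\<^sub>R Z w" for w
  define m where "m = distr \<gamma> borel V"
  have [measurable]: "V \<in> borel_measurable \<gamma>" unfolding V_def by measurable
  have iX: "integrable \<gamma> (\<lambda>w. (norm (X w))\<^sup>2)" using distr_in_P2_iff[OF \<gamma>, of X] law P by simp
  have iY: "integrable \<gamma> (\<lambda>w. (norm (Y w))\<^sup>2)" using distr_in_P2_iff[OF \<gamma>, of Y] law P by simp
  have iZ: "integrable \<gamma> (\<lambda>w. (norm (Z w))\<^sup>2)" using distr_in_P2_iff[OF \<gamma>, of Z] law P by simp
  have iXY: "integrable \<gamma> (\<lambda>w. (norm (X w - Y w))\<^sup>2)" by (intro square_integrable_diff iX iY) simp_all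
  have iXZ: "integrable \<gamma> (\<lambda>w. (norm (X w - Z w))\<^sup>2)" by (intro square_integrable_diff iX iZ) simp_all
  have iYZ: "integrable \<gamma> (\<lambda>w. (norm (Y w - Z w))\<^sup>2)" by (intro square_integrable_diff iY iZ) simp_all
  have V_sq: "(norm (V w))\<^sup>2 = (1 - t) * (norm (Y w))\<^sup>2 + t * (norm (Z w))\<^sup>2 - t * (1 - t) * (norm (Y w - Z w))\<^sup>2" for w
    unfolding norm_diff_sq unfolding V_def power2_norm_eq_inner
    by (simp add: inner_add_left inner_add_right inner_commute[of "Z w" "Y w"]) (simp add: algebra_simps)
  have iV: "integrable \<gamma> (\<lambda>w. (norm (V w))\<^sup>2)"
    unfolding V_sq by (intro Bochner_Integration.integrable_add Bochner_Integration.integrable_diff integrable_mult_right iY iZ iYZ)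
  then have m: "m \<in> P2" unfolding m_def by (subst distr_in_P2_iff[OF \<gamma>]) simp_all
  have XV_sq: "(norm (X w - V w))\<^sup>2 = (1 - t) * (norm (X w - Y w))\<^sup>2 + t * (norm (X w - Z w))\<^sup>2 - t * (1 - t) * (norm (Y w - Z w))\<^sup>2" for w
    unfolding norm_diff_sq V_sq unfolding V_def
    by (simp add: inner_add_right) (simp add: algebra_simps)
  have YZ: "(Wasserstein 2 \<mu>0 \<mu>1)\<^sup>2 \<le> (\<integral>w. (norm (Y w - Z w))\<^sup>2 \<partial>\<gamma>)"
    by (rule Wasserstein_2_le[OF \<gamma> _ _ law(2,3) P(2,3)]) simp_all
  have "(Wasserstein 2 \<nu> m)\<^sup>2 \<le> (\<integral>w. (norm (X w - V w))\<^sup>2 \<partial>\<gamma>)"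
    by (rule Wasserstein_2_le[OF \<gamma> _ _ law(1) m_def[symmetric] P(1) m]) simp_all
  also have "\<dots> = (1 - t) * (Wasserstein 2 \<nu> \<mu>0)\<^sup>2 + t * (Wasserstein 2 \<nu> \<mu>1)\<^sup>2 - t * (1 - t) * (\<integral>w. (norm (Y w - Z w))\<^sup>2 \<partial>\<gamma>)"
    unfolding XV_sq using iXY iXZ iYZ XY XZ by simp
  also have "\<dots> \<le> (1 - t) * (Wasserstein 2 \<nu> \<mu>0)\<^sup>2 + t * (Wasserstein 2 \<nu> \<mu>1)\<^sup>2 - t * (1 - t) * (Wasserstein 2 \<mu>0 \<mu>1)\<^sup>2"
    using YZ t by (intro diff_left_mono mult_left_mono) auto
  finally have "(Wasserstein 2 m \<nu>)\<^sup>2 \<le> (1 - t) * (Wasserstein 2 \<mu>0 \<nu>)\<^sup>2 + t * (Wasserstein 2 \<mu>1 \<nu>)\<^sup>2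
      - t * (1 - t) * (Wasserstein 2 \<mu>0 \<mu>1)\<^sup>2"
    unfolding Wasserstein_2_commute[OF P(1) m] Wasserstein_2_commute[OF P(1,2)] Wasserstein_2_commute[OF P(1,3)] .
  moreover have "G m \<le> ereal (1 - t) * G \<mu>0 + ereal t * G \<mu>1"
    using Gt t unfolding m_def V_def[abs_def] by blast
  ultimately show ?thesis using m by blast
qed

section \<open>Proximal points\<close>

lemma P2_skorohod_subseq:
  fixes \<mu> :: "nat \<Rightarrow> 'a::euclidean_space measure"
  assumes "\<And>n. \<mu> n \<in> P2" "\<And>n. second_moment (\<mu> n) \<le> C"
  shows "\<exists>r \<rho> \<Omega> X Y. strict_mono r \<and> skorohod_representation (\<mu> \<circ> r) \<rho> \<Omega> X Y"
proof (rule skorohod_representation_exists[where C = "ennreal C"])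
  show "prob_space (\<mu> n)" "sets (\<mu> n) = sets borel" for n using P2D(1,2)[OF assms(1)] .
  show "(\<integral>\<^sup>+ x. ennreal ((norm x)\<^sup>2) \<partial>\<mu> n) \<le> ennreal C" for n
    unfolding P2D(4)[OF assms(1)] by (rule ennreal_leI[OF assms(2)])
qed simp

text \<open>Subtracting the partial sums of the errors leaves a decreasing sequence, bounded below
  by \<open>- suminf \<epsilon>\<close>.\<close>

lemma convergent_quasi_decreasing:
  fixes a \<epsilon> :: "nat \<Rightarrow> real"
  assumes "\<And>n. 0 \<le> a n" "\<And>n. 0 \<le> \<epsilon> n" "summable \<epsilon>" "\<And>n. a (Suc n) \<le> a n + \<epsilon> n"
  shows "convergent a"
proof -
  have "(\<lambda>n. \<Sum>i<n. \<epsilon> i) \<longlonglongrightarrow> suminf \<epsilon>" using assms(3) by (rule summable_LIMSEQ)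
  moreover have "convergent (\<lambda>n. a n - (\<Sum>i<n. \<epsilon> i))"
  proof -
    have "decseq (\<lambda>n. a n - (\<Sum>i<n. \<epsilon> i))"
      by (rule decseq_SucI) (use assms(4) in \<open>simp add: algebra_simps\<close>)
    moreover have "- suminf \<epsilon> \<le> a n - (\<Sum>i<n. \<epsilon> i)" for n
      using sum_le_suminf[OF assms(3), of "{..<n}"] assms(1)[of n] assms(2) by simp
    ultimately obtain l where "(\<lambda>n. a n - (\<Sum>i<n. \<epsilon> i)) \<longlonglongrightarrow> l"
      using decseq_convergent[of "\<lambda>n. a n - (\<Sum>i<n. \<epsilon> i)" "- suminf \<epsilon>"] by blast
    then show ?thesis by (rule convergentI)
  qed
  ultimately have "convergent (\<lambda>n. (a n - (\<Sum>i<n. \<epsilon> i)) + (\<Sum>i<n. \<epsilon> i))"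
    by (intro convergent_add) (auto intro: convergentI)
  then show ?thesis by simp
qed

text \<open>Here \<open>a\<close> and \<open>b\<close> are the distances of the iterates and of the
  proximal points to a minimizer, and \<open>d\<close> is the gap of the values at the proximal
  points. Telescoping the squares of \<open>a\<close> bounds the sum of
  \<open>\<tau> i * d i\<close>; almost monotonicity of \<open>d\<close> converts this average bound
  into a bound for the last term.\<close>

lemma inexact_prox_rate:
  fixes a b d \<epsilon> \<tau> :: "nat \<Rightarrow> real"
  assumes pos: "\<And>n. 0 \<le> a n" "\<And>n. 0 \<le> b n" "\<And>n. 0 \<le> d n" "\<And>n. 0 \<le> \<epsilon> n" "\<And>n. 0 < \<tau> n"
    and sm: "summable \<epsilon>" "summable (\<lambda>n. (\<Sum>i<Suc n. \<tau> i) / \<tau> (Suc n) * (\<epsilon> n)\<^sup>2)"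
    and step: "\<And>n. 2 * \<tau> n * d n \<le> (a n)\<^sup>2 - (b n)\<^sup>2" "\<And>n. a (Suc n) \<le> b n + \<epsilon> n"
      "\<And>n. d (Suc n) \<le> d n + (\<epsilon> n)\<^sup>2 / (2 * \<tau> (Suc n))"
  shows "\<exists>C. \<forall>n. (\<Sum>i<Suc n. \<tau> i) * d n \<le> C"
proof -
  have ba: "b n \<le> a n" for n
  proof (rule power2_le_imp_le)
    have "0 \<le> 2 * \<tau> n * d n" using pos(3,5)[of n] by simp
    then show "(b n)\<^sup>2 \<le> (a n)\<^sup>2" using step(1)[of n] by linarith
  qed (rule pos)
  have "a (Suc n) \<le> a n + \<epsilon> n" for n using step(2)[of n] ba[of n] by linarith
  then have "Bseq a" by (intro convergent_imp_Bseq convergent_quasi_decreasing[of a \<epsilon>] pos sm)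
  then obtain M where M: "0 < M" "\<And>n. a n \<le> M" unfolding Bseq_def using pos(1) by (metis abs_of_nonneg real_norm_def)
  define E where "E = suminf \<epsilon>"
  have sum_E: "sum \<epsilon> {..<n} \<le> E" for n unfolding E_def by (rule sum_le_suminf[OF sm(1)]) (auto intro: pos)
  have \<epsilon>_E: "\<epsilon> n \<le> E" for n
    using sum_le_suminf[OF sm(1), of "{n}"] pos(4) by (simp add: E_def)
  have E0: "0 \<le> E" using \<epsilon>_E[of 0] pos(4)[of 0] by linarith
  \<comment> \<open>Replacing \<open>b n\<close> by \<open>a (Suc n)\<close> costs
    \<open>(2 * b n + \<epsilon> n) * \<epsilon> n\<close>, and the factor is uniformly bounded, so
    summability of \<open>\<epsilon>\<close> controls the total.\<close>
  have one: "2 * (\<tau> n * d n) \<le> (a n)\<^sup>2 - (a (Suc n))\<^sup>2 + (2 * M + E) * \<epsilon> n" for n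
  proof -
    have "(a (Suc n))\<^sup>2 \<le> (b n + \<epsilon> n)\<^sup>2" using step(2)[of n] pos(1) by (intro power_mono)
    also have "\<dots> = (b n)\<^sup>2 + (2 * b n + \<epsilon> n) * \<epsilon> n" by (simp add: power2_eq_square algebra_simps)
    also have "(2 * b n + \<epsilon> n) * \<epsilon> n \<le> (2 * M + E) * \<epsilon> n"
      using ba[of n] M(2)[of n] \<epsilon>_E[of n] pos(4)[of n] by (intro mult_right_mono) auto
    finally show ?thesis using step(1)[of n] by simp
  qed
  have sum_td: "2 * (\<Sum>i<n. \<tau> i * d i) \<le> M\<^sup>2 + (2 * M + E) * E" for n
  proof -
    have "2 * (\<Sum>i<n. \<tau> i * d i) \<le> (\<Sum>i<n. (a i)\<^sup>2 - (a (Suc i))\<^sup>2 + (2 * M + E) * \<epsilon> i)"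
      unfolding sum_distrib_left by (intro sum_mono one)
    also have "\<dots> = (a 0)\<^sup>2 - (a n)\<^sup>2 + (2 * M + E) * (\<Sum>i<n. \<epsilon> i)"
      by (simp add: sum.distrib sum_lessThan_telescope'[of "\<lambda>i. (a i)\<^sup>2"] sum_distrib_left)
    also have "\<dots> \<le> (a 0)\<^sup>2 + (2 * M + E) * E"
      using sum_E[of n] M(1) E0 by (intro add_mono mult_left_mono) auto
    also have "(a 0)\<^sup>2 \<le> M\<^sup>2" using M(2) pos(1) by (intro power_mono)
    finally show ?thesis by simp
  qed
  let ?s = "\<lambda>n. (\<Sum>i<Suc n. \<tau> i) / \<tau> (Suc n) * (\<epsilon> n)\<^sup>2"
  have s0: "0 \<le> ?s n" for n using pos(5) by (intro mult_nonneg_nonneg divide_nonneg_nonneg sum_nonneg) (auto simp: less_imp_le)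
  have half_le: "z / 2 \<le> z" if "0 \<le> z" for z :: real using that by simp
  \<comment> \<open>Abel summation by induction: the new weight pays for the new term of the first
    sum, and the growth of \<open>d\<close> under the old weights costs \<open>?s n / 2\<close>,
    rounded up to \<open>?s n\<close>.\<close>
  have "(\<Sum>i<Suc n. \<tau> i) * d n \<le> (\<Sum>i<Suc n. \<tau> i * d i) + (\<Sum>i<n. ?s i)" for n
  proof (induction n)
    case (Suc n)
    have S: "0 \<le> (\<Sum>i<Suc n. \<tau> i)" using pos(5) by (intro sum_nonneg) (simp add: less_imp_le)
    have "(\<Sum>i<Suc (Suc n). \<tau> i) * d (Suc n) = \<tau> (Suc n) * d (Suc n) + (\<Sum>i<Suc n. \<tau> i) * d (Suc n)"
      by (simp add: algebra_simps)
    also have "(\<Sum>i<Suc n. \<tau> i) * d (Suc n) \<le> (\<Sum>i<Suc n. \<tau> i) * (d n + (\<epsilon> n)\<^sup>2 / (2 * \<tau> (Suc n)))"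
      using S step(3)[of n] by (rule mult_left_mono[rotated])
    also have "\<dots> = (\<Sum>i<Suc n. \<tau> i) * d n + ?s n / 2"
      by (simp only: distrib_left) simp
    also have "?s n / 2 \<le> ?s n" using s0[of n] by (rule half_le)
    finally show ?case using Suc.IH by simp
  qed simp
  also have "(\<Sum>i<Suc n. \<tau> i * d i) + (\<Sum>i<n. ?s i) \<le> (M\<^sup>2 + (2 * M + E) * E) / 2 + suminf ?s" for n
  proof (rule add_mono)
    show "(\<Sum>i<Suc n. \<tau> i * d i) \<le> (M\<^sup>2 + (2 * M + E) * E) / 2"
      using sum_td[of "Suc n"] by (simp only: le_divide_eq_numeral1 mult.commute)
    show "(\<Sum>i<n. ?s i) \<le> suminf ?s"
      using s0 by (intro sum_le_suminf sm) auto
  qed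
  finally show ?thesis by blast
qed

lemma abs_square_diff_le:
  fixes u v :: real
  assumes "\<bar>u - v\<bar> \<le> \<delta>" "0 \<le> u" "0 \<le> v" "v \<le> B"
  shows "\<bar>u\<^sup>2 - v\<^sup>2\<bar> \<le> \<delta> * (2 * B + \<delta>)"
proof -
  have "u\<^sup>2 - v\<^sup>2 = (u - v) * (u + v)" by (simp add: power2_eq_square algebra_simps)
  then have "\<bar>u\<^sup>2 - v\<^sup>2\<bar> = \<bar>u - v\<bar> * (u + v)"
    using assms(2,3) by (simp add: abs_mult)
  also have "\<dots> \<le> \<delta> * (2 * B + \<delta>)" using assms by (intro mult_mono) auto
  finally show ?thesis .
qed

section \<open>Proximal points and weak limits for a fixed functional\<close>

locale prox_functional =
  fixes G :: "'a::euclidean_space measure \<Rightarrow> ereal"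
  assumes proper: "proper_on_P2 G" and lsc: "lsc_W2 G"
    and conv: "convex_along_gen_geodesics G" and argmin: "argmin_P2 G \<noteq> {}"
begin

abbreviation W :: "'a measure \<Rightarrow> 'a measure \<Rightarrow> real" where "W \<equiv> Wasserstein 2"

definition dom :: "'a measure set" where "dom = {\<mu>\<in>P2. G \<mu> \<noteq> \<infinity>}"

text \<open>Real values permit linear arithmetic. At an infinite value \<open>real_of_ereal\<close>
  returns 0, hence the restriction to \<open>dom\<close> throughout.\<close>

definition g :: "'a measure \<Rightarrow> real" where "g \<mu> = real_of_ereal (G \<mu>)"

lemma dom_P2: "\<mu> \<in> dom \<Longrightarrow> \<mu> \<in> P2"
  by (simp add: dom_def)

lemma G_eq: "\<mu> \<in> dom \<Longrightarrow> G \<mu> = ereal (g \<mu>)"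
  using proper by (auto simp: dom_def g_def proper_on_P2_def ereal_real)

lemma domI:
  assumes "\<mu> \<in> P2" "G \<mu> \<le> ereal c"
  shows "\<mu> \<in> dom" "g \<mu> \<le> c"
proof -
  show "\<mu> \<in> dom" using assms by (auto simp: dom_def)
  then show "g \<mu> \<le> c" using assms(2) by (simp add: G_eq)
qed

lemma argmin_iff: "x \<in> argmin_P2 G \<longleftrightarrow> x \<in> dom \<and> (\<forall>\<nu>\<in>dom. g x \<le> g \<nu>)"
proof
  assume "x \<in> argmin_P2 G"
  then have x: "x \<in> P2" "\<And>\<nu>. \<nu> \<in> P2 \<Longrightarrow> G x \<le> G \<nu>"
    by (auto simp: argmin_P2_def is_arg_min_def not_less)
  obtain y where "y \<in> P2" "G y \<noteq> \<infinity>" using proper by (auto simp: proper_on_P2_def)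
  then have "x \<in> dom" using x(2)[of y] x(1) by (auto simp: dom_def)
  then show "x \<in> dom \<and> (\<forall>\<nu>\<in>dom. g x \<le> g \<nu>)"
    using x(2) G_eq dom_P2 by (metis ereal_less_eq(3))
next
  assume x: "x \<in> dom \<and> (\<forall>\<nu>\<in>dom. g x \<le> g \<nu>)"
  have "G x \<le> G \<nu>" if "\<nu> \<in> P2" for \<nu>
  proof (cases "\<nu> \<in> dom")
    case True
    then show ?thesis using x by (simp add: G_eq)
  next
    case False
    then show ?thesis using that by (simp add: dom_def)
  qed
  then show "x \<in> argmin_P2 G" using x dom_P2 by (auto simp: argmin_P2_def is_arg_min_def not_less)
qed

lemma triangle: "x \<in> P2 \<Longrightarrow> y \<in> P2 \<Longrightarrow> z \<in> P2 \<Longrightarrow> W x z \<le> W x y + W y z"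
  by (rule Wasserstein_2_triangle[OF conv])

lemma W_abs_diff:
  assumes "x \<in> P2" "y \<in> P2" "z \<in> P2"
  shows "\<bar>W x z - W y z\<bar> \<le> W x y"
  using triangle[of x y z] triangle[of y x z] Wasserstein_2_commute[of x y] assms by simp

lemma geodesic:
  assumes "\<nu> \<in> P2" "\<mu>0 \<in> dom" "\<mu>1 \<in> dom" "t \<in> {0..1}"
  shows "\<exists>m\<in>dom. g m \<le> (1 - t) * g \<mu>0 + t * g \<mu>1 \<and>
    (W m \<nu>)\<^sup>2 \<le> (1 - t) * (W \<mu>0 \<nu>)\<^sup>2 + t * (W \<mu>1 \<nu>)\<^sup>2 - t * (1 - t) * (W \<mu>0 \<mu>1)\<^sup>2"
proof -
  obtain m where m: "m \<in> P2" "G m \<le> ereal (1 - t) * G \<mu>0 + ereal t * G \<mu>1"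
    "(W m \<nu>)\<^sup>2 \<le> (1 - t) * (W \<mu>0 \<nu>)\<^sup>2 + t * (W \<mu>1 \<nu>)\<^sup>2 - t * (1 - t) * (W \<mu>0 \<mu>1)\<^sup>2"
    using gen_geodesic_point[OF conv assms(1) dom_P2[OF assms(2)] dom_P2[OF assms(3)] assms(4)] by blast
  have "G m \<le> ereal ((1 - t) * g \<mu>0 + t * g \<mu>1)"
    using m(2) assms by (simp add: G_eq)
  then show ?thesis using domI[OF m(1)] m(3) by blast
qed

text \<open>Majorants \<open>c n\<close> are used because the values \<open>g (\<nu> n)\<close>
  themselves are not known to converge; their finite limit also places \<open>\<mu>\<close> in
  \<open>dom\<close>.\<close>

lemma lsc_dom:
  assumes \<nu>: "\<And>n. \<nu> n \<in> dom" "(\<lambda>n. W (\<nu> n) \<mu>) \<longlonglongrightarrow> 0" and \<mu>: "\<mu> \<in> P2"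
    and c: "\<And>n. g (\<nu> n) \<le> c n" "c \<longlonglongrightarrow> l"
  shows "\<mu> \<in> dom" "g \<mu> \<le> l"
proof -
  have "G \<mu> \<le> liminf (\<lambda>n. G (\<nu> n))"
    using lsc \<mu> \<nu> dom_P2 unfolding lsc_W2_def by blast
  also have "\<dots> \<le> liminf (\<lambda>n. ereal (c n))"
    using c(1) \<nu>(1) by (intro Liminf_mono always_eventually allI) (simp add: G_eq)
  also have "\<dots> = ereal l" using c(2) by (intro lim_imp_Liminf) simp_all
  finally show "\<mu> \<in> dom" "g \<mu> \<le> l" using domI[OF \<mu>] by simp_all
qed

definition is_prox :: "real \<Rightarrow> 'a measure \<Rightarrow> 'a measure \<Rightarrow> bool" where
  "is_prox \<tau> \<mu> \<rho> \<longleftrightarrow> \<rho> \<in> dom \<and>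
     (\<forall>\<nu>\<in>dom. g \<rho> + 1 / (2 * \<tau>) * (W \<rho> \<mu>)\<^sup>2 \<le> g \<nu> + 1 / (2 * \<tau>) * (W \<nu> \<mu>)\<^sup>2)"

text \<open>The penalty is finite, so the penalized functional is infinite at the same measures as
  \<open>G\<close>. As \<open>dom\<close> is nonempty, its minimizers lie in
  \<open>dom\<close>.\<close>

lemma argmin_prox_iff:
  "\<rho> \<in> argmin_P2 (\<lambda>\<nu>. G \<nu> + ereal (1 / (2 * \<tau>) * (W \<nu> \<mu>)\<^sup>2)) \<longleftrightarrow> is_prox \<tau> \<mu> \<rho>"
proof -
  define F where "F = (\<lambda>\<nu>. G \<nu> + ereal (1 / (2 * \<tau>) * (W \<nu> \<mu>)\<^sup>2))"
  have F: "F \<nu> = ereal (g \<nu> + 1 / (2 * \<tau>) * (W \<nu> \<mu>)\<^sup>2)" if "\<nu> \<in> dom" for \<nu>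
    using that by (simp add: F_def G_eq)
  have F_inf: "F \<nu> = \<infinity>" if "\<nu> \<in> P2" "\<nu> \<notin> dom" for \<nu>
    using that by (simp add: F_def dom_def)
  obtain y where y: "y \<in> dom" using proper by (auto simp: proper_on_P2_def dom_def)
  have "\<rho> \<in> argmin_P2 F \<longleftrightarrow> \<rho> \<in> P2 \<and> (\<forall>\<nu>\<in>P2. F \<rho> \<le> F \<nu>)"
    by (auto simp: argmin_P2_def is_arg_min_def not_less)
  also have "\<dots> \<longleftrightarrow> \<rho> \<in> dom \<and> (\<forall>\<nu>\<in>dom. F \<rho> \<le> F \<nu>)"
  proof (intro iffI conjI ballI; elim conjE)
    assume *: "\<rho> \<in> P2" "\<forall>\<nu>\<in>P2. F \<rho> \<le> F \<nu>"
    show "\<rho> \<in> dom"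
    proof (rule ccontr)
      assume "\<rho> \<notin> dom"
      then have "F \<rho> = \<infinity>" using F_inf * by blast
      moreover have "F \<rho> \<le> F y" using * y dom_P2 by blast
      ultimately show False using F[OF y] by simp
    qed
  next
    fix \<nu> :: "'a measure" assume *: "\<rho> \<in> dom" "\<forall>\<nu>\<in>dom. F \<rho> \<le> F \<nu>" "\<nu> \<in> P2"
    then show "F \<rho> \<le> F \<nu>" using F_inf[of \<nu>] by (cases "\<nu> \<in> dom") auto
  qed (auto dest: dom_P2)
  also have "\<dots> \<longleftrightarrow> is_prox \<tau> \<mu> \<rho>"
    unfolding is_prox_def using F by (metis ereal_less_eq(3))
  finally show ?thesis unfolding F_def .
qed

text \<open>The proximal point is compared with the point at time t of a generalized geodesic from
  \<open>\<rho>\<close> to \<open>\<nu>\<close> with base \<open>\<mu>\<close>. Dividing by t leaves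
  the claim up to \<open>t * (W \<rho> \<nu>)\<^sup>2\<close>, which vanishes as t tends to
  0.\<close>

lemma prox_EVI:
  assumes prox: "is_prox \<tau> \<mu> \<rho>" and \<tau>: "0 < \<tau>" and \<mu>: "\<mu> \<in> P2" and \<nu>: "\<nu> \<in> dom"
  shows "(W \<rho> \<nu>)\<^sup>2 \<le> (W \<nu> \<mu>)\<^sup>2 - 2 * \<tau> * (g \<rho> - g \<nu>) - (W \<rho> \<mu>)\<^sup>2"
proof -
  have \<rho>: "\<rho> \<in> dom" using prox by (simp add: is_prox_def)
  let ?a = "(W \<rho> \<mu>)\<^sup>2" and ?b = "(W \<nu> \<mu>)\<^sup>2" and ?c = "(W \<rho> \<nu>)\<^sup>2"
  have le: "?c \<le> ?b - 2 * \<tau> * (g \<rho> - g \<nu>) - ?a + t * ?c" if t: "0 < t" "t < 1" for t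
  proof -
    obtain m where m: "m \<in> dom" "g m \<le> (1 - t) * g \<rho> + t * g \<nu>"
      "(W m \<mu>)\<^sup>2 \<le> (1 - t) * ?a + t * ?b - t * (1 - t) * ?c"
      using geodesic[OF \<mu> \<rho> \<nu>, of t] t by auto
    have "2 * \<tau> * (g \<rho> + 1 / (2 * \<tau>) * ?a) \<le> 2 * \<tau> * (g m + 1 / (2 * \<tau>) * (W m \<mu>)\<^sup>2)"
      using prox m(1) \<tau> unfolding is_prox_def by (intro mult_left_mono) auto
    then have "2 * \<tau> * g \<rho> + ?a \<le> 2 * \<tau> * g m + (W m \<mu>)\<^sup>2"
      using \<tau> by (simp add: distrib_left)
    also have "\<dots> \<le> 2 * \<tau> * ((1 - t) * g \<rho> + t * g \<nu>) + ((1 - t) * ?a + t * ?b - t * (1 - t) * ?c)"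
      using m \<tau> by (intro add_mono mult_left_mono) auto
    finally have "t * (2 * \<tau> * (g \<rho> - g \<nu>) + ?a - ?b + ?c - t * ?c) \<le> 0"
      by (simp add: algebra_simps)
    then show ?thesis using t(1) by (simp add: mult_le_0_iff)
  qed
  show ?thesis
  proof (rule field_le_epsilon)
    fix e :: real assume e: "0 < e"
    define t where "t = min (1 / 2) (e / (?c + 1))"
    have c1: "0 < ?c + 1" by (simp add: add_nonneg_pos)
    then have t: "0 < t" "t < 1" using e by (auto simp: t_def)
    have "t * ?c \<le> e / (?c + 1) * (?c + 1)"
      using e c1 by (intro mult_mono) (auto simp: t_def)
    then have "t * ?c \<le> e" using c1 by simp
    then show "?c \<le> ?b - 2 * \<tau> * (g \<rho> - g \<nu>) - ?a + e" using le[OF t] by linarith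
  qed
qed

text \<open>Testing the variational inequality of each point with the other and adding cancels
  everything but the two squared distances.\<close>

lemma prox_unique:
  assumes "is_prox \<tau> \<mu> \<rho>" "is_prox \<tau> \<mu> \<rho>'" "0 < \<tau>" "\<mu> \<in> P2"
  shows "\<rho> = \<rho>'"
proof -
  have dom: "\<rho> \<in> dom" "\<rho>' \<in> dom" using assms by (auto simp: is_prox_def)
  have "(W \<rho> \<rho>')\<^sup>2 + (W \<rho>' \<rho>)\<^sup>2 \<le> 0"
    using prox_EVI[OF assms(1,3,4) dom(2)] prox_EVI[OF assms(2-4) dom(1)] by (simp add: algebra_simps)
  then have "W \<rho> \<rho>' = 0" by (simp add: sum_power2_le_zero_iff)
  then show ?thesis using Wasserstein_2_eq_0_imp_eq[OF conv] dom dom_P2 by blast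
qed

text \<open>Completeness from compactness: the Opial inequality with test measure
  \<open>\<nu> (r k)\<close>, after dropping its first term, shows that the distance to
  \<open>\<nu> (r k)\<close> does not increase in the weak limit.\<close>

lemma Cauchy_subseq_limit:
  assumes P: "\<And>n. \<nu> n \<in> P2" and \<eta>: "\<And>i j. i \<le> j \<Longrightarrow> (W (\<nu> j) (\<nu> i))\<^sup>2 \<le> \<eta> i" "\<eta> \<longlonglongrightarrow> 0"
  shows "\<exists>r \<rho>. strict_mono r \<and> \<rho> \<in> P2 \<and> (\<lambda>n. W (\<nu> (r n)) \<rho>) \<longlonglongrightarrow> 0"
proof -
  have C: "second_moment (\<nu> n) \<le> 2 * \<eta> 0 + 2 * second_moment (\<nu> 0)" for n
    using second_moment_le[OF P P, of n 0] \<eta>(1)[of 0 n] by linarith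
  obtain r \<rho> \<Omega> X Y where r: "strict_mono r" and rep: "skorohod_representation (\<nu> \<circ> r) \<rho> \<Omega> X Y"
    using P2_skorohod_subseq[of \<nu>, OF P C] by (elim exE conjE) (rule that)
  have P': "(\<nu> \<circ> r) n \<in> P2" and C': "second_moment ((\<nu> \<circ> r) n) \<le> 2 * \<eta> 0 + 2 * second_moment (\<nu> 0)" for n
    using P C by simp_all
  have \<rho>: "\<rho> \<in> P2" by (rule skorohod_representation_P2(1)[OF rep P' C'])
  have le: "(W (\<nu> (r k)) \<rho>)\<^sup>2 \<le> \<eta> (r k)" for k
  proof (rule field_le_epsilon)
    fix e :: real assume "0 < e"
    from Opial_Wasserstein[OF rep P' C' P[of "r k"] this, of k]
    obtain n where n: "n \<ge> k" "(W (\<nu> (r n)) \<rho>)\<^sup>2 + (W \<rho> (\<nu> (r k)))\<^sup>2 \<le> (W (\<nu> (r n)) (\<nu> (r k)))\<^sup>2 + e" by auto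
    have "(W (\<nu> (r n)) (\<nu> (r k)))\<^sup>2 \<le> \<eta> (r k)" using n(1) r by (intro \<eta>(1)) (simp add: strict_mono_less_eq)
    then show "(W (\<nu> (r k)) \<rho>)\<^sup>2 \<le> \<eta> (r k) + e"
      using n(2) zero_le_power2[of "W (\<nu> (r n)) \<rho>"]
      unfolding Wasserstein_2_commute[OF \<rho> P[of "r k"]] by linarith
  qed
  have "(\<lambda>k. \<eta> (r k)) \<longlonglongrightarrow> 0" using LIMSEQ_subseq_LIMSEQ[OF \<eta>(2) r] by (simp add: comp_def)
  then have "(\<lambda>k. (W (\<nu> (r k)) \<rho>)\<^sup>2) \<longlonglongrightarrow> 0"
    by (rule tendsto_sandwich[OF _ _ tendsto_const, rotated 2]) (use le in auto)
  then have "(\<lambda>k. sqrt ((W (\<nu> (r k)) \<rho>)\<^sup>2)) \<longlonglongrightarrow> sqrt 0" by (rule tendsto_real_sqrt)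
  then show ?thesis using r \<rho> by auto
qed

text \<open>Strong convexity of the penalized functional along generalized geodesics with base
  \<open>\<mu>\<close> makes minimizing sequences Cauchy; a minimizer of \<open>G\<close> bounds the
  infimum from below.\<close>

lemma prox_exists:
  assumes \<tau>: "0 < \<tau>" and \<mu>: "\<mu> \<in> P2"
  shows "\<exists>\<rho>. is_prox \<tau> \<mu> \<rho>"
proof -
  define F where "F \<nu> = g \<nu> + 1 / (2 * \<tau>) * (W \<nu> \<mu>)\<^sup>2" for \<nu>
  obtain x where x: "x \<in> dom" "\<And>\<nu>. \<nu> \<in> dom \<Longrightarrow> g x \<le> g \<nu>" using argmin argmin_iff by blast
  have lower: "g x \<le> F \<nu>" if "\<nu> \<in> dom" for \<nu>
    using x(2)[OF that] \<tau> by (simp add: F_def add_increasing2)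
  have bdd: "bdd_below (F ` dom)" using lower by (intro bdd_belowI[of _ "g x"]) auto
  define I where "I = Inf (F ` dom)"
  have I_le: "I \<le> F \<nu>" if "\<nu> \<in> dom" for \<nu> unfolding I_def using that bdd by (intro cInf_lower) auto
  have "\<exists>\<nu>\<in>dom. F \<nu> < I + 1 / Suc n" for n
  proof -
    have "Inf (F ` dom) < I + 1 / Suc n" by (simp add: I_def)
    then show ?thesis using x(1) by (subst (asm) cInf_less_iff[OF _ bdd]) auto
  qed
  then obtain \<nu> where \<nu>: "\<And>n. \<nu> n \<in> dom" "\<And>n. F (\<nu> n) < I + 1 / Suc n" by metis
  have P: "\<nu> n \<in> P2" for n using \<nu>(1) dom_P2 by blast
  have cauchy: "(W (\<nu> j) (\<nu> i))\<^sup>2 \<le> 8 * \<tau> / Suc i" if "i \<le> j" for i j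
  proof -
    \<comment> \<open>At the midpoint the gain t (1 - t) / (2 \<tau>) equals 1 / (8 \<tau>), the
      source of the constant in \<open>cauchy\<close>.\<close>
    obtain m where m: "m \<in> dom" "g m \<le> (1 - 1/2) * g (\<nu> j) + 1/2 * g (\<nu> i)"
      "(W m \<mu>)\<^sup>2 \<le> (1 - 1/2) * (W (\<nu> j) \<mu>)\<^sup>2 + 1/2 * (W (\<nu> i) \<mu>)\<^sup>2 - 1/2 * (1 - 1/2) * (W (\<nu> j) (\<nu> i))\<^sup>2"
      using geodesic[OF \<mu> \<nu>(1) \<nu>(1), of "1/2" j i] by auto
    have "F m \<le> ((1 - 1/2) * g (\<nu> j) + 1/2 * g (\<nu> i)) + 1 / (2 * \<tau>) *
      ((1 - 1/2) * (W (\<nu> j) \<mu>)\<^sup>2 + 1/2 * (W (\<nu> i) \<mu>)\<^sup>2 - 1/2 * (1 - 1/2) * (W (\<nu> j) (\<nu> i))\<^sup>2)"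
      unfolding F_def using m \<tau> by (intro add_mono mult_left_mono) auto
    also have "\<dots> = (F (\<nu> j) + F (\<nu> i)) / 2 - (W (\<nu> j) (\<nu> i))\<^sup>2 / (8 * \<tau>)"
      unfolding F_def using \<tau> by (simp add: field_simps)
    finally have "I \<le> (F (\<nu> j) + F (\<nu> i)) / 2 - (W (\<nu> j) (\<nu> i))\<^sup>2 / (8 * \<tau>)"
      using I_le[OF m(1)] by linarith
    moreover have "F (\<nu> j) \<le> I + 1 / Suc i"
    proof -
      have "1 / real (Suc j) \<le> 1 / real (Suc i)" using that by (simp add: frac_le)
      then show ?thesis using \<nu>(2)[of j] by linarith
    qed
    moreover have "w \<le> u" if "I \<le> (a + b) / 2 - w" "a \<le> I + u" "b < I + u" for a b u w
      using that by (simp add: field_simps)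
    ultimately have "(W (\<nu> j) (\<nu> i))\<^sup>2 / (8 * \<tau>) \<le> 1 / real (Suc i)"
      using \<nu>(2)[of i] by blast
    then have "8 * \<tau> * ((W (\<nu> j) (\<nu> i))\<^sup>2 / (8 * \<tau>)) \<le> 8 * \<tau> * (1 / real (Suc i))"
      using \<tau> by (intro mult_left_mono) auto
    then show ?thesis using \<tau> by simp
  qed
  have "(\<lambda>i. 8 * \<tau> * (1 / real (Suc i))) \<longlonglongrightarrow> 8 * \<tau> * 0"
    by (intro tendsto_intros LIMSEQ_Suc lim_1_over_n)
  then have "(\<lambda>i. 8 * \<tau> / real (Suc i)) \<longlonglongrightarrow> 0" by simp
  from Cauchy_subseq_limit[of \<nu>, OF P cauchy this]
  obtain r \<rho> where r: "strict_mono (r :: nat \<Rightarrow> nat)" "\<rho> \<in> P2" "(\<lambda>n. W (\<nu> (r n)) \<rho>) \<longlonglongrightarrow> 0" by blast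
  have "(\<lambda>n. W (\<nu> (r n)) \<mu> - W \<rho> \<mu>) \<longlonglongrightarrow> 0"
    by (rule Lim_null_comparison[OF _ r(3)]) (use W_abs_diff[OF P r(2) \<mu>] in simp)
  then have Wlim: "(\<lambda>n. W (\<nu> (r n)) \<mu>) \<longlonglongrightarrow> W \<rho> \<mu>" by (rule LIM_zero_cancel)
  \<comment> \<open>Majorant of \<open>g\<close> along the subsequence: the bound on
    \<open>F\<close> minus the penalty, whose limit is known because W is continuous in its first
    argument.\<close>
  define c where "c n = I + 1 / real (Suc (r n)) - 1 / (2 * \<tau>) * (W (\<nu> (r n)) \<mu>)\<^sup>2" for n
  have "(\<lambda>n. 1 / real (Suc (r n))) \<longlonglongrightarrow> 0"
    using LIMSEQ_subseq_LIMSEQ[OF LIMSEQ_Suc[OF lim_1_over_n] r(1)] by (simp add: comp_def)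
  then have "c \<longlonglongrightarrow> I + 0 - 1 / (2 * \<tau>) * (W \<rho> \<mu>)\<^sup>2"
    unfolding c_def by (intro tendsto_intros Wlim)
  moreover have "g (\<nu> (r n)) \<le> c n" for n using \<nu>(2)[of "r n"] by (simp add: c_def F_def)
  ultimately have "\<rho> \<in> dom" "g \<rho> \<le> I + 0 - 1 / (2 * \<tau>) * (W \<rho> \<mu>)\<^sup>2"
    using lsc_dom[of "\<lambda>n. \<nu> (r n)" \<rho> c] \<nu>(1) r(2,3) by blast+
  then have "is_prox \<tau> \<mu> \<rho>" using I_le unfolding is_prox_def F_def by fastforce
  then show ?thesis by blast
qed

lemma JKO_is_prox:
  assumes "0 < \<tau>" "\<mu> \<in> P2"
  shows "is_prox \<tau> \<mu> (JKO G \<tau> \<mu>)"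
  unfolding JKO_def argmin_prox_iff
  by (rule theI') (use prox_exists[OF assms] prox_unique[OF _ _ assms] in blast)

text \<open>The iterates may have infinite value, so nearby \<open>\<nu> n\<close> carry the values.
  For the proximal point p of q with step 1, the variational inequality tested with
  \<open>\<nu> n\<close> is added to the Opial inequality for q and p. Distances from
  \<open>\<mu> n\<close> and \<open>\<nu> n\<close> cancel up to a small error, leaving
  \<open>2 * (W p q)\<^sup>2 + 2 * (g p - g x) \<le> 0\<close>; so p equals q and has minimal
  value.\<close>

lemma weak_limit_minimizer:
  assumes rep: "skorohod_representation \<mu> q \<Omega> X Y" and P: "\<And>n. \<mu> n \<in> P2"
    and x: "x \<in> argmin_P2 G" and M: "\<And>n. W (\<mu> n) x \<le> M"
    and \<nu>: "\<And>n. \<nu> n \<in> dom" "(\<lambda>n. W (\<nu> n) (\<mu> n)) \<longlonglongrightarrow> 0" "(\<lambda>n. g (\<nu> n)) \<longlonglongrightarrow> g x"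
  shows "q \<in> argmin_P2 G"
proof -
  have xd: "x \<in> dom" and x_min: "\<And>\<nu>. \<nu> \<in> dom \<Longrightarrow> g x \<le> g \<nu>" using x argmin_iff by auto
  have xP: "x \<in> P2" using xd by (rule dom_P2)
  have C: "second_moment (\<mu> n) \<le> 2 * M\<^sup>2 + 2 * second_moment x" for n
    using second_moment_le[OF P xP, of n] power_mono[OF M, of n 2] by simp
  have q: "q \<in> P2" by (rule skorohod_representation_P2(1)[OF rep P C])
  obtain p where p: "is_prox 1 q p" using prox_exists[OF _ q, of 1] by auto
  have pd: "p \<in> dom" using p by (simp add: is_prox_def)
  have pP: "p \<in> P2" using pd by (rule dom_P2)
  have \<nu>P: "\<nu> n \<in> P2" for n using \<nu>(1) by (rule dom_P2)
  define B where "B = M + W x p + W x q"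
  have B: "W (\<mu> n) p \<le> B" "W (\<mu> n) q \<le> B" for n
    using triangle[OF P xP pP, of n] triangle[OF P xP q, of n] M[of n]
      Wasserstein_nonneg[of 2 x p] Wasserstein_nonneg[of 2 x q] unfolding B_def by linarith+
  \<comment> \<open>The error of exchanging \<open>\<mu> n\<close> for \<open>\<nu> n\<close> in a
    squared distance to p or q; it vanishes because \<open>B\<close> bounds these distances.\<close>
  define \<eta> where "\<eta> n = W (\<nu> n) (\<mu> n) * (2 * B + W (\<nu> n) (\<mu> n))" for n
  have \<eta>: "\<bar>(W (\<nu> n) z)\<^sup>2 - (W (\<mu> n) z)\<^sup>2\<bar> \<le> \<eta> n" if "z \<in> {p, q}" for n z
    unfolding \<eta>_def using that B W_abs_diff[OF \<nu>P P, of z n n] pP q by (intro abs_square_diff_le) auto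
  have "(\<lambda>n. 2 * (g (\<nu> n) - g x) + 2 * \<eta> n) \<longlonglongrightarrow> 2 * (g x - g x) + 2 * (0 * (2 * B + 0))"
    unfolding \<eta>_def by (intro tendsto_intros \<nu>)
  then have lim: "(\<lambda>n. 2 * (g (\<nu> n) - g x) + 2 * \<eta> n) \<longlonglongrightarrow> 0" by simp
  have key: "2 * (W p q)\<^sup>2 + 2 * (g p - g x) \<le> e" if e: "0 < e" for e
  proof -
    have "\<forall>\<^sub>F n in sequentially. 2 * (g (\<nu> n) - g x) + 2 * \<eta> n < e / 2"
      using lim e by (intro order_tendstoD) auto
    then obtain N where N: "\<And>n. n \<ge> N \<Longrightarrow> 2 * (g (\<nu> n) - g x) + 2 * \<eta> n < e / 2"
      by (auto simp: eventually_sequentially)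
    obtain n where n: "n \<ge> N" "(W (\<mu> n) q)\<^sup>2 + (W q p)\<^sup>2 \<le> (W (\<mu> n) p)\<^sup>2 + e / 2"
      using Opial_Wasserstein[OF rep P C pP, of "e / 2" N] e by auto
    have "(W p (\<nu> n))\<^sup>2 \<le> (W (\<nu> n) q)\<^sup>2 - 2 * 1 * (g p - g (\<nu> n)) - (W p q)\<^sup>2"
      by (rule prox_EVI[OF p _ q \<nu>(1)]) simp
    moreover have "(W (\<nu> n) q)\<^sup>2 \<le> (W (\<mu> n) q)\<^sup>2 + \<eta> n" "(W (\<mu> n) p)\<^sup>2 \<le> (W (\<nu> n) p)\<^sup>2 + \<eta> n"
      using \<eta>[of q n] \<eta>[of p n] by auto
    moreover have "W p (\<nu> n) = W (\<nu> n) p" "W q p = W p q"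
      using Wasserstein_2_commute pP q \<nu>P by blast+
    ultimately show ?thesis using N[OF n(1)] n(2) by simp
  qed
  have gp: "g x \<le> g p" using x_min pd by blast
  have "2 * (W p q)\<^sup>2 + 2 * (g p - g x) \<le> 0" by (rule field_le_epsilon) (use key in simp)
  then have "(W p q)\<^sup>2 + g p \<le> g x" by simp
  then have "(W p q)\<^sup>2 \<le> 0" and "g p \<le> g x" using gp zero_le_power2[of "W p q"] by linarith+
  then have "p = q" using Wasserstein_2_eq_0_imp_eq[OF conv pP q] by simp
  moreover have "g p \<le> g \<nu>'" if "\<nu>' \<in> dom" for \<nu>' using \<open>g p \<le> g x\<close> x_min[OF that] by linarith
  ultimately show ?thesis using pd unfolding argmin_iff by blast
qed

text \<open>Opial's argument: if the distances to q and q' tend to \<alpha> and \<beta>, each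
  subsequence makes its own limit the strictly closer one unless q = q'. The two inequalities for
  \<alpha> and \<beta> add up to distance 0.\<close>

lemma weak_limits_agree:
  assumes rep: "skorohod_representation (\<mu> \<circ> r) q \<Omega> X Y" "skorohod_representation (\<mu> \<circ> r') q' \<Omega>' X' Y'"
    and r: "strict_mono r" "strict_mono r'"
    and P: "\<And>n. \<mu> n \<in> P2" and C: "\<And>n. second_moment (\<mu> n) \<le> C"
    and cq: "convergent (\<lambda>n. W (\<mu> n) q)" "convergent (\<lambda>n. W (\<mu> n) q')"
  shows "q = q'"
proof -
  have P': "(\<mu> \<circ> s) n \<in> P2" and C': "second_moment ((\<mu> \<circ> s) n) \<le> C" for s n
    using P C by simp_all
  have q: "q \<in> P2" "q' \<in> P2"
    by (rule skorohod_representation_P2(1)[OF rep(1) P' C'], rule skorohod_representation_P2(1)[OF rep(2) P' C'])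
  have le: "\<alpha>\<^sup>2 + (W p p')\<^sup>2 \<le> \<beta>\<^sup>2"
    if rep: "skorohod_representation (\<mu> \<circ> s) p \<Omega> X Y" and s: "strict_mono s" and p': "p' \<in> P2"
      and \<alpha>: "(\<lambda>n. W (\<mu> n) p) \<longlonglongrightarrow> \<alpha>" and \<beta>: "(\<lambda>n. W (\<mu> n) p') \<longlonglongrightarrow> \<beta>" for s p p' \<Omega> X Y \<alpha> \<beta>
  proof (rule field_le_epsilon)
    fix e :: real assume e: "0 < e"
    have "(\<lambda>n. (W (\<mu> n) p)\<^sup>2 - (W (\<mu> n) p')\<^sup>2) \<longlonglongrightarrow> \<alpha>\<^sup>2 - \<beta>\<^sup>2" by (intro tendsto_intros \<alpha> \<beta>)
    then have "\<forall>\<^sub>F n in sequentially. \<alpha>\<^sup>2 - \<beta>\<^sup>2 - e / 2 < (W (\<mu> n) p)\<^sup>2 - (W (\<mu> n) p')\<^sup>2"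
      using e by (intro order_tendstoD) auto
    then obtain N where N: "\<And>n. n \<ge> N \<Longrightarrow> \<alpha>\<^sup>2 - \<beta>\<^sup>2 - e / 2 < (W (\<mu> n) p)\<^sup>2 - (W (\<mu> n) p')\<^sup>2"
      by (auto simp: eventually_sequentially)
    obtain n where n: "n \<ge> N" "(W (\<mu> (s n)) p)\<^sup>2 + (W p p')\<^sup>2 \<le> (W (\<mu> (s n)) p')\<^sup>2 + e / 2"
      using Opial_Wasserstein[OF rep P' C' p', of "e / 2" N] e by auto
    have "N \<le> s n" using n(1) seq_suble[OF s, of n] by linarith
    from N[OF this] n(2) show "\<alpha>\<^sup>2 + (W p p')\<^sup>2 \<le> \<beta>\<^sup>2 + e" by linarith
  qed
  obtain \<alpha> \<beta> where lims: "(\<lambda>n. W (\<mu> n) q) \<longlonglongrightarrow> \<alpha>" "(\<lambda>n. W (\<mu> n) q') \<longlonglongrightarrow> \<beta>"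
    using cq by (auto simp: convergent_def)
  have "(W q q')\<^sup>2 \<le> 0"
    using le[OF rep(1) r(1) q(2) lims] le[OF rep(2) r(2) q(1) lims(2,1)] zero_le_power2[of "W q' q"] by linarith
  then show ?thesis using Wasserstein_2_eq_0_imp_eq[OF conv q] by simp
qed

end

section \<open>Convergence of the inexact proximal point algorithm\<close>

theorem theorem1p1:
  fixes G :: "(real ^ 'd) measure \<Rightarrow> ereal"
    and \<epsilon> \<tau> \<sigma> :: "nat \<Rightarrow> real"
    and \<mu> :: "nat \<Rightarrow> (real ^ 'd) measure"
  assumes "proper_on_P2 G" and "lsc_W2 G" and "convex_along_gen_geodesics G"
    and "argmin_P2 G \<noteq> {}"
    and "\<And>n. \<epsilon> n \<ge> 0" and "summable \<epsilon>"
    and "\<And>n. \<tau> n > 0" and "filterlim (\<lambda>n. \<Sum>i<n. \<tau> i) at_top sequentially"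
    and "\<And>n. \<sigma> n = (\<Sum>i<n. \<tau> i)"
    and "summable (\<lambda>n. \<sigma> (Suc n) / \<tau> (Suc n) * (\<epsilon> n)\<^sup>2)"
    and "\<And>n. \<mu> n \<in> P2"
    and "\<And>n. Wasserstein 2 (\<mu> (Suc n)) (JKO G (\<tau> n) (\<mu> n)) \<le> \<epsilon> n"
  shows "(\<exists>r \<in> O(\<lambda>n. 1 / \<sigma> n). \<forall>\<^sub>F n in sequentially.
            G (JKO G (\<tau> n) (\<mu> n)) - (INF \<nu>\<in>P2. G \<nu>) = ereal (r n)) \<and>
         (\<exists>\<mu>' \<in> argmin_P2 G. \<forall>p\<in>{1..<2}. (\<lambda>n. Wasserstein p (\<mu> n) \<mu>') \<longlonglongrightarrow> 0)"
proof -
  interpret prox_functional G by unfold_locales fact+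
  note \<epsilon>0 = assms(5) and sm_\<epsilon> = assms(6) and \<tau>0 = assms(7) and \<sigma> = assms(9) and \<mu>P = assms(11)
  define \<rho> where "\<rho> n = JKO G (\<tau> n) (\<mu> n)" for n
  have prox: "is_prox (\<tau> n) (\<mu> n) (\<rho> n)" for n unfolding \<rho>_def by (rule JKO_is_prox[OF \<tau>0 \<mu>P])
  then have \<rho>d: "\<rho> n \<in> dom" for n by (simp add: is_prox_def)
  then have \<rho>P: "\<rho> n \<in> P2" for n by (rule dom_P2)
  note EVI = prox_EVI[OF prox \<tau>0 \<mu>P]
  have step: "W (\<mu> (Suc n)) (\<rho> n) \<le> \<epsilon> n" for n using assms(12) by (simp add: \<rho>_def)
  obtain x where x: "x \<in> argmin_P2 G" using argmin by blast
  have xd: "x \<in> dom" and x_min: "\<And>\<nu>. \<nu> \<in> dom \<Longrightarrow> g x \<le> g \<nu>" using x argmin_iff by auto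
  have xP: "x \<in> P2" using xd by (rule dom_P2)
  have EVI_min: "2 * \<tau> n * (g (\<rho> n) - g y) \<le> (W (\<mu> n) y)\<^sup>2 - (W (\<rho> n) y)\<^sup>2" if "y \<in> dom" for n y
    using EVI[OF that, of n] zero_le_power2[of "W (\<rho> n) (\<mu> n)"]
    unfolding Wasserstein_2_commute[OF dom_P2[OF that] \<mu>P[of n]] by linarith
  have next_le: "W (\<mu> (Suc n)) y \<le> W (\<rho> n) y + \<epsilon> n" if "y \<in> P2" for n y
    using triangle[OF \<mu>P \<rho>P that, of "Suc n" n] step[of n] by linarith
  have fejer: "convergent (\<lambda>n. W (\<mu> n) y)" if y: "y \<in> argmin_P2 G" for y
  proof (rule convergent_quasi_decreasing[of _ \<epsilon>])
    fix n
    have yd: "y \<in> dom" "g y \<le> g (\<rho> n)" using y \<rho>d[of n] argmin_iff by auto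
    have "0 \<le> 2 * \<tau> n * (g (\<rho> n) - g y)" using yd \<tau>0[of n] by simp
    then have "(W (\<rho> n) y)\<^sup>2 \<le> (W (\<mu> n) y)\<^sup>2" using EVI_min[OF yd(1), of n] by linarith
    then have "W (\<rho> n) y \<le> W (\<mu> n) y" by (rule power2_le_imp_le) simp
    then show "W (\<mu> (Suc n)) y \<le> W (\<mu> n) y + \<epsilon> n" using next_le[OF dom_P2[OF yd(1)], of n] by linarith
  qed (simp_all add: \<epsilon>0 sm_\<epsilon>)
  define d where "d n = g (\<rho> n) - g x" for n
  have d0: "0 \<le> d n" for n using x_min[OF \<rho>d] by (simp add: d_def)
  have "\<exists>C. \<forall>n. (\<Sum>i<Suc n. \<tau> i) * d n \<le> C"
  proof (rule inexact_prox_rate)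
    show "2 * \<tau> n * d n \<le> (W (\<mu> n) x)\<^sup>2 - (W (\<rho> n) x)\<^sup>2" for n
      unfolding d_def by (rule EVI_min[OF xd])
    show "W (\<mu> (Suc n)) x \<le> W (\<rho> n) x + \<epsilon> n" for n by (rule next_le[OF xP])
    show "d (Suc n) \<le> d n + (\<epsilon> n)\<^sup>2 / (2 * \<tau> (Suc n))" for n
    proof -
      have "2 * \<tau> (Suc n) * (g (\<rho> (Suc n)) - g (\<rho> n)) \<le> (W (\<mu> (Suc n)) (\<rho> n))\<^sup>2"
        using EVI_min[OF \<rho>d[of n], of "Suc n"] zero_le_power2[of "W (\<rho> (Suc n)) (\<rho> n)"] by linarith
      also have "\<dots> \<le> (\<epsilon> n)\<^sup>2" using step by (intro power_mono) simp_all
      finally have "g (\<rho> (Suc n)) - g (\<rho> n) \<le> (\<epsilon> n)\<^sup>2 / (2 * \<tau> (Suc n))"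
        using \<tau>0[of "Suc n"] by (simp add: pos_le_divide_eq mult.commute)
      then show ?thesis by (simp add: d_def)
    qed
    show "summable (\<lambda>n. (\<Sum>i<Suc n. \<tau> i) / \<tau> (Suc n) * (\<epsilon> n)\<^sup>2)"
      using assms(10) unfolding \<sigma> .
  qed (simp_all add: d0 \<epsilon>0 sm_\<epsilon> \<tau>0)
  then obtain C where "\<And>n. (\<Sum>i<Suc n. \<tau> i) * d n \<le> C" by blast
  \<comment> \<open>Off by one: \<open>\<sigma> n\<close> stops before \<open>\<tau> n\<close>,
    whereas the bound just obtained includes it and is therefore stronger.\<close>
  moreover have "\<sigma> n * d n \<le> (\<Sum>i<Suc n. \<tau> i) * d n" for n
    using \<tau>0[of n] d0[of n] by (intro mult_right_mono) (simp_all add: \<sigma>)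
  ultimately have C: "\<sigma> n * d n \<le> C" for n using order_trans by blast
  have \<sigma>_lim: "filterlim \<sigma> at_top sequentially" using assms(8) by (simp add: \<sigma>[abs_def])
  \<comment> \<open>\<open>\<sigma> 0\<close> is 0, so dividing by \<open>\<sigma> n\<close> makes
    sense only eventually.\<close>
  have \<sigma>_pos: "\<forall>\<^sub>F n in sequentially. 0 < \<sigma> n" using \<sigma>_lim by (simp add: filterlim_at_top_dense)
  have d_le: "\<forall>\<^sub>F n in sequentially. d n \<le> C / \<sigma> n"
    using \<sigma>_pos by eventually_elim (use C in \<open>simp add: pos_le_divide_eq mult.commute\<close>)
  have C_lim: "(\<lambda>n. C / \<sigma> n) \<longlonglongrightarrow> 0" using \<sigma>_lim by (rule real_tendsto_divide_at_top[OF tendsto_const])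
  have d_lim: "d \<longlonglongrightarrow> 0"
    by (rule tendsto_sandwich[OF _ d_le tendsto_const C_lim]) (simp add: d0)
  have "d \<in> O(\<lambda>n. 1 / \<sigma> n)"
  proof (rule bigoI)
    show "\<forall>\<^sub>F n in sequentially. norm (d n) \<le> C * norm (1 / \<sigma> n)"
      using d_le \<sigma>_pos by eventually_elim (simp add: d0)
  qed
  moreover have "G (JKO G (\<tau> n) (\<mu> n)) - (INF \<nu>\<in>P2. G \<nu>) = ereal (d n)" for n
  proof -
    have "(INF \<nu>\<in>P2. G \<nu>) = G x"
      using x by (intro antisym INF_lower INF_greatest xP) (simp add: argmin_P2_def is_arg_min_def not_less)
    then show ?thesis using G_eq[OF \<rho>d, of n] G_eq[OF xd] by (simp add: \<rho>_def d_def)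
  qed
  ultimately have rate: "\<exists>r \<in> O(\<lambda>n. 1 / \<sigma> n). \<forall>\<^sub>F n in sequentially.
            G (JKO G (\<tau> n) (\<mu> n)) - (INF \<nu>\<in>P2. G \<nu>) = ereal (r n)"
    by (intro bexI[of _ d] always_eventually allI)
  have "Bseq (\<lambda>n. W (\<mu> n) x)" by (rule convergent_imp_Bseq[OF fejer[OF x]])
  then obtain M where M: "\<And>n. W (\<mu> n) x \<le> M" unfolding Bseq_def by (auto simp: real_norm_def)
  have C2: "second_moment (\<mu> n) \<le> 2 * M\<^sup>2 + 2 * second_moment x" for n
    using second_moment_le[OF \<mu>P xP, of n] power_mono[OF M, of n 2] by simp
  have cluster: "q \<in> argmin_P2 G" if rep: "skorohod_representation (\<mu> \<circ> r) q \<Omega> X Y" and r: "strict_mono r" for r q \<Omega> X Y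
  proof -
    \<comment> \<open>The iterate with index \<open>r (Suc n)\<close> is close to the proximal point
      one index earlier. Starting from \<open>Suc n\<close> keeps this index positive, so the
      subtraction on \<open>nat\<close> is genuine.\<close>
    have r': "strict_mono (\<lambda>n. r (Suc n) - 1)"
    proof (rule strict_monoI_Suc)
      fix n show "r (Suc n) - 1 < r (Suc (Suc n)) - 1"
        using strict_monoD[OF r, of "Suc n" "Suc (Suc n)"] seq_suble[OF r, of "Suc n"] by linarith
    qed
    have rS: "r (Suc n) = Suc (r (Suc n) - 1)" for n using seq_suble[OF r, of "Suc n"] by linarith
    have "\<epsilon> \<longlonglongrightarrow> 0" using sm_\<epsilon> by (rule summable_LIMSEQ_zero)
    then have \<epsilon>_lim: "(\<lambda>n. \<epsilon> (r (Suc n) - 1)) \<longlonglongrightarrow> 0" using LIMSEQ_subseq_LIMSEQ[OF _ r'] by (simp add: comp_def)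
    have rep': "skorohod_representation (\<mu> \<circ> r \<circ> Suc) q \<Omega> (X \<circ> Suc) Y"
      by (rule skorohod_representation_subseq[OF rep]) (simp add: strict_mono_Suc_iff)
    show ?thesis
    proof (rule weak_limit_minimizer[OF rep' _ x, of M "\<lambda>n. \<rho> (r (Suc n) - 1)"])
      show "(\<lambda>n. W (\<rho> (r (Suc n) - 1)) ((\<mu> \<circ> r \<circ> Suc) n)) \<longlonglongrightarrow> 0"
      proof (rule tendsto_sandwich[OF _ _ tendsto_const \<epsilon>_lim])
        show "\<forall>\<^sub>F n in sequentially. W (\<rho> (r (Suc n) - 1)) ((\<mu> \<circ> r \<circ> Suc) n) \<le> \<epsilon> (r (Suc n) - 1)"
        proof (intro always_eventually allI)
          fix n
          show "W (\<rho> (r (Suc n) - 1)) ((\<mu> \<circ> r \<circ> Suc) n) \<le> \<epsilon> (r (Suc n) - 1)"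
            using step[of "r (Suc n) - 1"] unfolding rS[of n, symmetric] comp_apply
            by (subst Wasserstein_2_commute[OF \<rho>P \<mu>P])
        qed
      qed simp
      show "(\<lambda>n. g (\<rho> (r (Suc n) - 1))) \<longlonglongrightarrow> g x"
        using LIMSEQ_subseq_LIMSEQ[OF d_lim r'] by (simp add: comp_def d_def LIM_zero_iff)
    qed (simp_all add: \<mu>P M \<rho>d)
  qed
  obtain r q \<Omega> X Y where r: "strict_mono (r :: nat \<Rightarrow> nat)" and rep: "skorohod_representation (\<mu> \<circ> r) q \<Omega> X Y"
    using P2_skorohod_subseq[of \<mu>, OF \<mu>P C2] by (elim exE conjE) (rule that)
  have q: "q \<in> argmin_P2 G" by (rule cluster[OF rep r])
  have "(\<lambda>n. Wasserstein p (\<mu> n) q) \<longlonglongrightarrow> 0" if p: "p \<in> {1..<2}" for p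
  proof (rule LIMSEQ_subsubseq)
    fix s :: "nat \<Rightarrow> nat" assume s: "strict_mono s"
    have P': "(\<mu> \<circ> v) n \<in> P2" "second_moment ((\<mu> \<circ> v) n) \<le> 2 * M\<^sup>2 + 2 * second_moment x" for v n
      using \<mu>P C2 by simp_all
    obtain s' q' \<Omega>' X' Y' where s': "strict_mono (s' :: nat \<Rightarrow> nat)"
      and rep'': "skorohod_representation (\<mu> \<circ> s \<circ> s') q' \<Omega>' X' Y'"
      using P2_skorohod_subseq[of "\<mu> \<circ> s", OF P'] by (elim exE conjE) (rule that)
    then have rep': "skorohod_representation (\<mu> \<circ> (s \<circ> s')) q' \<Omega>' X' Y'" by (simp add: comp_assoc)
    have ss: "strict_mono (s \<circ> s')" using s s' by (rule strict_mono_o)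
    \<comment> \<open>Distances to a measure are known to converge when it is a minimizer, so both
      cluster points must pass through \<open>cluster\<close> first.\<close>
    have "q = q'"
      by (rule weak_limits_agree[OF rep rep' r ss \<mu>P C2 fejer[OF q] fejer[OF cluster[OF rep' ss]]])
    then have "(\<lambda>n. Wasserstein p ((\<mu> \<circ> (s \<circ> s')) n) q) \<longlonglongrightarrow> 0"
      using Wasserstein_tendsto_zero[OF rep' P'] p by simp
    then show "\<exists>s'. strict_mono s' \<and> ((\<lambda>n. Wasserstein p (\<mu> n) q) \<circ> s \<circ> s') \<longlonglongrightarrow> 0"
      using s' by (auto simp: comp_def)
  qed
  then show ?thesis using rate q by blast
qed

end
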